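(* Fix $n\geq2$, let $\phi=(f_1,\ldots,f_n)\colon\mathbb{C}\dashrightarrow\mathbb{C}^n$ be a rational map and $X=\overline{\mathrm{im}(\phi)}$. Assume that the linear span of $X$ is all of $\mathbb{C}^n$. Then $\mathfrak{g}_X\neq\{0\}$ if and only if, after a linear change of coordinates on $\mathbb{C}^n$, we have $f_i=r^{e_i}$ for $i=1,\ldots,n$, for some non-constant rational function $r$ and integer exponents $e_1<e_2<\cdots<e_n$ with $\gcd(e_1,\ldots,e_n)=1$. Moreover, in this case, $\mathfrak{g}_X$ is one-dimensional, unless $(e_1,\ldots,e_n)$ is $(0,\ldots,n-1)$ or $(-n+1,\ldots,0)$, in which case $\mathfrak{g}_X$ is two-dimensional.
   Context: Closures are Zariski closures. $\mathfrak{g}_X\subseteq\mathfrak{gl}_n(\mathbb{C})$ is the Lie algebra of the Zariski closed group $G_X=\{g\in\mathrm{GL}_n(\mathbb{C})\mid gX=X\}$. The $f_i$ are rational functions in $\mathbb{C}(t)$; a linear change of coordinates replaces $\phi$ by $g\phi$ for some $g\in\mathrm{GL}_n(\mathbb{C})$. *)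

theory Defs
  imports "HOL-Analysis.Analysis" "HOL-Computational_Algebra.Computational_Algebra"
    "HOL-Computational_Algebra.Field_as_Ring"
begin

(* The polynomial functions on a space whose coordinate functions are the elements of C;
   over the infinite field of complex numbers these are the same thing as polynomials. *)

inductive polyfun :: "('a \<Rightarrow> complex) set \<Rightarrow> ('a \<Rightarrow> complex) \<Rightarrow> bool"
  for C :: "('a \<Rightarrow> complex) set" where
  const: "polyfun C (\<lambda>_. c)"
| coord: "p \<in> C \<Longrightarrow> polyfun C p"
| add: "polyfun C p \<Longrightarrow> polyfun C q \<Longrightarrow> polyfun C (\<lambda>x. p x + q x)"
| mult: "polyfun C p \<Longrightarrow> polyfun C q \<Longrightarrow> polyfun C (\<lambda>x. p x * q x)"

definition vec_coords :: "(complex ^ 'n \<Rightarrow> complex) set" where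
  "vec_coords = range (\<lambda>i v. v $ i)"

definition mat_coords :: "(complex ^ 'n ^ 'n \<Rightarrow> complex) set" where
  "mat_coords = {(\<lambda>A. A $ i $ j) | i j. True}"

definition zariski_closure :: "(complex ^ 'n) set \<Rightarrow> (complex ^ 'n) set" where
  "zariski_closure S =
     {x. \<forall>p. polyfun vec_coords p \<longrightarrow> (\<forall>y\<in>S. p y = 0) \<longrightarrow> p x = 0}"

(* The symmetry group G_X of X in GL_n. *)

definition linear_symmetries :: "(complex ^ 'n) set \<Rightarrow> (complex ^ 'n ^ 'n) set" where
  "linear_symmetries X = {g. invertible g \<and> (\<lambda>x. g *v x) ` X = X}"

definition mat_scale :: "complex \<Rightarrow> complex ^ 'n ^ 'n \<Rightarrow> complex ^ 'n ^ 'n" where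
  "mat_scale c A = (\<chi> i j. c * A $ i $ j)"

interpretation cmat: vector_space mat_scale
  by unfold_locales (simp_all add: mat_scale_def vec_eq_iff algebra_simps)

(* The Lie algebra of a Zariski closed subgroup G of GL_n, as the Zariski tangent space of G
   at the identity: the matrices A along which the differential at the identity of every
   polynomial vanishing on G is zero.  Polynomials in the matrix entries suffice here (no
   inverse of the determinant), since GL_n is open in the space of all matrices. *)

definition lie_algebra :: "(complex ^ 'n ^ 'n) set \<Rightarrow> (complex ^ 'n ^ 'n) set" where
  "lie_algebra G =
     {A. \<forall>p. polyfun mat_coords p \<longrightarrow> (\<forall>g\<in>G. p g = 0) \<longrightarrow>
        ((\<lambda>s. p (mat 1 + mat_scale s A)) has_field_derivative 0) (at 0)}"

(* The field of rational functions is the fraction field of the polynomial ring;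
   quot_of_fract yields numerator and denominator in lowest terms. *)

type_synonym ratfun = "complex poly fract"

definition rf_const :: "complex \<Rightarrow> ratfun" where
  "rf_const c = to_fract [:c:]"

definition rf_regular_at :: "ratfun \<Rightarrow> complex \<Rightarrow> bool" where
  "rf_regular_at f t \<longleftrightarrow> poly (snd (quot_of_fract f)) t \<noteq> 0"

definition rf_eval :: "ratfun \<Rightarrow> complex \<Rightarrow> complex" where
  "rf_eval f t = poly (fst (quot_of_fract f)) t / poly (snd (quot_of_fract f)) t"

definition ratmap_image :: "ratfun ^ 'n \<Rightarrow> (complex ^ 'n) set" where
  "ratmap_image \<phi> = {(\<chi> i. rf_eval (\<phi> $ i) t) | t. \<forall>i. rf_regular_at (\<phi> $ i) t}"

(* After the coordinate change g, the map \<phi> has components r^(e i). *)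

definition power_form ::
    "ratfun ^ ('n::{finite,linorder}) \<Rightarrow> complex ^ ('n::{finite,linorder}) ^ ('n::{finite,linorder}) \<Rightarrow>
     ratfun \<Rightarrow> ('n \<Rightarrow> int) \<Rightarrow> bool" where
  "power_form \<phi> g r e \<longleftrightarrow>
     invertible g \<and> r \<notin> range rf_const \<and> strict_mono e \<and> Gcd (range e) = 1 \<and>
     map_matrix rf_const g *v \<phi> = (\<chi> i. r powi e i)"

(* The position of i in the ordered index type, counted from 0. *)

definition index :: "'n::{finite,linorder} \<Rightarrow> nat" where
  "index i = card {..<i}"

end

theory Submission
  imports Defs
begin

text \<open>
  Write \<open>K\<close> for the field of rational functions in one variable and
  \<open>V \<subseteq> K\<close> for the span of the components of \<open>\<phi>\<close>. They are linearly independent, since a linear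
  relation between them would hold on \<open>X\<close> and hence on its span.

  An infinitesimal symmetry \<open>A\<close> moves every point of \<open>X\<close> in a direction tangent to \<open>X\<close>. Since \<open>X\<close> is
  a curve parametrized by \<open>\<phi>\<close>, this says \<open>A \<phi> = w \<phi>'\<close> for a single \<open>w \<in> K\<close> (\<open>rf_tangent\<close>), so \<open>V\<close> is
  stable under the vector field \<open>\<delta> = w d/dt\<close>, and \<open>w \<noteq> 0\<close> as soon as \<open>A \<noteq> 0\<close>. Finite-dimensional
  \<open>\<delta>\<close>-stable subspaces of \<open>K\<close> are of two kinds.

  If \<open>\<delta> z = 1\<close> for some \<open>z \<in> K\<close>, then \<open>\<delta>\<close> has no eigenvector in \<open>K\<close> with a nonzero eigenvalue: it would
  be an exponential of a multiple of \<open>z\<close>, and a logarithmic derivative \<open>u'/u\<close> has simple poles while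
  \<open>z'\<close> has none (\<open>rf_no_exponential\<close>). Hence \<open>\<delta>\<close> is nilpotent on \<open>V\<close>, and \<open>V\<close> consists of the
  polynomials in \<open>z\<close> of degree less than \<open>n\<close> (\<open>rf_translation_case\<close>, \<open>rf_translation_exponents\<close>).

  If there is no such \<open>z\<close>, then \<open>\<delta>\<close> is diagonalizable on \<open>V\<close>, because the quotient of a proper
  generalized eigenvector by the corresponding eigenvector would be a suitable multiple of such a \<open>z\<close>.
  Comparing orders of zeros and poles of eigenvectors at one point shows that their eigenvalues are
  integral multiples \<open>c e\<close> of one number \<open>c\<close>, where the integers \<open>e\<close> have greatest common divisor \<open>1\<close>;
  by Bezout a product \<open>r\<close> of powers of the eigenvectors has eigenvalue \<open>c\<close>, and every eigenvector is a
  constant times a power of \<open>r\<close> (\<open>rf_torus_exponents\<close>).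

  Conversely, in the coordinates where \<open>\<phi>\<close> has components \<open>r\<^bsup>e\<^sub>i\<^esup>\<close>, the curve \<open>X\<close> is the closure of
  the points \<open>(y\<^bsup>e\<^sub>i\<^esup>)\<close> with \<open>y \<noteq> 0\<close> (\<open>zariski_closure_power_form\<close>). Scaling \<open>y\<close> acts linearly on these
  points, which gives a nonzero element of the Lie algebra. If the exponents are \<open>0, \<dots>, n - 1\<close>, then by
  the binomial theorem translating \<open>y\<close> acts linearly as well and gives a second one; inverting \<open>y\<close>
  reduces the exponents \<open>-n + 1, \<dots>, 0\<close> to this case.

  There are no further symmetries: comparing coefficients in \<open>A \<phi> = w \<phi>'\<close> shows that in these coordinates
  an infinitesimal symmetry has entries \<open>e\<^sub>i h(e\<^sub>k - e\<^sub>i)\<close> for some function \<open>h\<close> on the integers, and that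
  \<open>h(d) \<noteq> 0\<close> requires \<open>e\<^sub>i + d\<close> to be an exponent whenever \<open>e\<^sub>i \<noteq> 0\<close> (\<open>power_form_symmetry_weights\<close>). For
  \<open>d \<noteq> 0\<close> the finiteness of the set of exponents and the condition on the greatest common divisor leave
  only the two exceptional sequences, with \<open>d = -1\<close> and \<open>d = 1\<close> (\<open>shifted_exponents\<close>).
\<close>

section \<open>Values of rational functions\<close>

lemma rf_quot: "f = to_fract (fst (quot_of_fract f)) / to_fract (snd (quot_of_fract f))"
  for f :: ratfun
  by (simp flip: Fract_conv_to_fract)

lemma rf_cases:
  fixes f :: ratfun
  obtains p q where "f = to_fract p / to_fract q" "q \<noteq> 0" "coprime p q"
  using rf_quot[of f] coprime_quot_of_fract[of f] snd_quot_of_fract_nonzero[of f] by blast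

lemma to_fract_quot_eq_iff:
  fixes a b c d :: "complex poly"
  assumes "b \<noteq> 0" "d \<noteq> 0"
  shows "to_fract a / to_fract b = to_fract c / to_fract d \<longleftrightarrow> a * d = c * b"
  using assms by (simp add: frac_eq_eq flip: to_fract_mult)

text \<open>Evaluation is defined through lowest terms. Any representation whose denominator does not
  vanish at the point gives the same value, because the denominator in lowest terms divides
  every other one. Together with \<open>rf_regular_cases\<close> this makes evaluation a ring homomorphism
  on the functions regular at the point.\<close>

lemma rf_eval_quot:
  assumes f: "f = to_fract a / to_fract b" and b: "poly b t \<noteq> 0"
  shows "rf_regular_at f t" "rf_eval f t = poly a t / poly b t"
proof -
  let ?p = "fst (quot_of_fract f)" and ?q = "snd (quot_of_fract f)"
  have "b \<noteq> 0" using b by auto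
  have eq: "?p * b = a * ?q"
    using rf_quot[of f] f \<open>b \<noteq> 0\<close> to_fract_quot_eq_iff[of ?q b ?p a] snd_quot_of_fract_nonzero[of f]
    by metis
  have "?q dvd ?p * b" using eq by simp
  then have "?q dvd b"
    using coprime_quot_of_fract[of f] by (simp add: coprime_dvd_mult_right_iff coprime_commute)
  then have q: "poly ?q t \<noteq> 0" using b by (auto elim!: dvdE)
  then show "rf_regular_at f t" by (simp add: rf_regular_at_def)
  have "poly ?p t * poly b t = poly a t * poly ?q t"
    using eq by (metis poly_mult)
  then show "rf_eval f t = poly a t / poly b t"
    using q b by (simp add: rf_eval_def field_simps)
qed

lemma rf_regular_cases:
  assumes "rf_regular_at f t"
  obtains p q where "f = to_fract p / to_fract q" "poly q t \<noteq> 0" "q \<noteq> 0"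
    "rf_eval f t = poly p t / poly q t"
  using assms rf_quot[of f] unfolding rf_regular_at_def rf_eval_def
  by (metis poly_0)

lemma rf_const_hom [simp]:
  "rf_const 0 = 0" "rf_const 1 = 1"
  "rf_const (a + b) = rf_const a + rf_const b"
  "rf_const (a - b) = rf_const a - rf_const b"
  "rf_const (a * b) = rf_const a * rf_const b"
  "rf_const (- a) = - rf_const a"
  by (simp_all add: rf_const_def flip: to_fract_add to_fract_diff to_fract_mult to_fract_uminus one_pCons)

lemma rf_const_eq_iff [simp]: "rf_const a = rf_const b \<longleftrightarrow> a = b"
  by (simp add: rf_const_def)

lemma rf_const_eq_0_iff [simp]: "rf_const a = 0 \<longleftrightarrow> a = 0"
  using rf_const_eq_iff[of a 0] by (simp del: rf_const_eq_iff)

lemma rf_const_inverse [simp]: "rf_const (inverse a) = inverse (rf_const a)"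
proof (cases "a = 0")
  case False
  then have "rf_const a * rf_const (inverse a) = 1" by (simp flip: rf_const_hom)
  then show ?thesis by (rule inverse_unique[symmetric])
qed simp

lemma rf_const_divide [simp]: "rf_const (a / b) = rf_const a / rf_const b"
  by (simp add: divide_inverse)

lemma rf_const_sum: "rf_const (sum f A) = (\<Sum>i\<in>A. rf_const (f i))"
  by (induction A rule: infinite_finite_induct) simp_all

lemma rf_const_of_nat [simp]: "rf_const (of_nat n) = of_nat n"
  by (induction n) simp_all

lemma rf_const_of_int [simp]: "rf_const (of_int n) = of_int n"
  by (cases n rule: int_cases2) simp_all

lemma rf_eval_const: "rf_regular_at (rf_const c) t \<and> rf_eval (rf_const c) t = c"
  using rf_eval_quot[of "rf_const c" "[:c:]" 1 t] by (simp add: rf_const_def)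

lemma rf_eval_add:
  assumes "rf_regular_at f t" "rf_regular_at g t"
  shows "rf_regular_at (f + g) t \<and> rf_eval (f + g) t = rf_eval f t + rf_eval g t"
proof -
  obtain p q where f: "f = to_fract p / to_fract q" "poly q t \<noteq> 0" "q \<noteq> 0"
    "rf_eval f t = poly p t / poly q t" using rf_regular_cases[OF assms(1)] .
  obtain p' q' where g: "g = to_fract p' / to_fract q'" "poly q' t \<noteq> 0" "q' \<noteq> 0"
    "rf_eval g t = poly p' t / poly q' t" using rf_regular_cases[OF assms(2)] .
  have "f + g = to_fract (p * q' + p' * q) / to_fract (q * q')"
    using f(3) g(3) by (simp add: f(1) g(1) add_frac_eq)
  from rf_eval_quot[OF this, of t] show ?thesis
    using f(2) g(2) by (simp add: f(4) g(4) add_frac_eq)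
qed

lemma rf_eval_mult:
  assumes "rf_regular_at f t" "rf_regular_at g t"
  shows "rf_regular_at (f * g) t \<and> rf_eval (f * g) t = rf_eval f t * rf_eval g t"
proof -
  obtain p q where f: "f = to_fract p / to_fract q" "poly q t \<noteq> 0" "q \<noteq> 0"
    "rf_eval f t = poly p t / poly q t" using rf_regular_cases[OF assms(1)] .
  obtain p' q' where g: "g = to_fract p' / to_fract q'" "poly q' t \<noteq> 0" "q' \<noteq> 0"
    "rf_eval g t = poly p' t / poly q' t" using rf_regular_cases[OF assms(2)] .
  have "f * g = to_fract (p * p') / to_fract (q * q')"
    by (simp add: f(1) g(1))
  from rf_eval_quot[OF this, of t] show ?thesis
    using f(2) g(2) by (simp add: f(4) g(4))
qed

lemma rf_eval_inverse:
  assumes "rf_regular_at f t" "rf_eval f t \<noteq> 0"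
  shows "rf_regular_at (inverse f) t \<and> rf_eval (inverse f) t = inverse (rf_eval f t)"
proof -
  obtain p q where f: "f = to_fract p / to_fract q" "poly q t \<noteq> 0" "q \<noteq> 0"
    "rf_eval f t = poly p t / poly q t" using rf_regular_cases[OF assms(1)] .
  have "inverse f = to_fract q / to_fract p" by (simp add: f(1))
  from rf_eval_quot[OF this, of t] show ?thesis
    using f(2) assms(2) by (auto simp: f(4))
qed

lemma rf_eval_power:
  assumes "rf_regular_at f t"
  shows "rf_regular_at (f ^ k) t \<and> rf_eval (f ^ k) t = rf_eval f t ^ k"
proof (induction k)
  case 0 show ?case using rf_eval_const[of 1 t] by simp
next
  case (Suc k) then show ?case using rf_eval_mult[OF assms, of "f ^ k"] by simp
qed

lemma rf_eval_power_int:
  assumes "rf_regular_at f t" "rf_eval f t \<noteq> 0"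
  shows "rf_regular_at (f powi k) t \<and> rf_eval (f powi k) t = rf_eval f t powi k"
  using rf_eval_power[OF assms(1)] rf_eval_inverse[OF assms]
    rf_eval_power[OF conjunct1[OF rf_eval_inverse[OF assms]], of "nat (-k)"]
  by (auto simp: power_int_def)

lemma rf_eval_sum:
  assumes "\<And>i. i \<in> A \<Longrightarrow> rf_regular_at (f i) t"
  shows "rf_regular_at (sum f A) t \<and> rf_eval (sum f A) t = (\<Sum>i\<in>A. rf_eval (f i) t)"
  using assms
proof (induction A rule: infinite_finite_induct)
  case (insert x F)
  then show ?case using rf_eval_add[of "f x" t "sum f F"] by auto
qed (use rf_eval_const[of 0 t] in simp_all)

lemma finite_not_regular: "finite {t. \<not> rf_regular_at f t}"
  using poly_roots_finite[OF snd_quot_of_fract_nonzero[of f]] by (simp add: rf_regular_at_def)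

text \<open>The numerator has only finitely many zeros. This is how identities between values are turned
  into identities in the function field.\<close>

lemma rf_eq_0I:
  assumes "infinite T" "\<And>t. t \<in> T \<Longrightarrow> rf_regular_at f t \<and> rf_eval f t = 0"
  shows "f = 0"
proof (rule ccontr)
  assume "f \<noteq> 0"
  then have "finite {t. poly (fst (quot_of_fract f)) t = 0}" by (simp add: poly_roots_finite)
  moreover have "T \<subseteq> {t. poly (fst (quot_of_fract f)) t = 0}"
    using assms(2) by (auto simp: rf_eval_def rf_regular_at_def)
  ultimately show False using assms(1) finite_subset by blast
qed

lemma rf_nonconst_fibre:
  assumes "r \<notin> range rf_const"
  shows "finite {t. rf_regular_at r t \<and> rf_eval r t = c}"
proof (rule ccontr)
  assume inf: "infinite {t. rf_regular_at r t \<and> rf_eval r t = c}" (is "infinite ?T")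
  have "r - rf_const c = 0"
  proof (rule rf_eq_0I[OF inf])
    fix t assume "t \<in> ?T"
    then show "rf_regular_at (r - rf_const c) t \<and> rf_eval (r - rf_const c) t = 0"
      using rf_eval_add[of r t "rf_const (-c)"] rf_eval_const[of "-c" t] by simp
  qed
  then show False using assms by auto
qed

section \<open>The derivation of the field of rational functions\<close>

definition rf_deriv :: "ratfun \<Rightarrow> ratfun" where
  "rf_deriv f = (let p = fst (quot_of_fract f); q = snd (quot_of_fract f)
     in to_fract (pderiv p * q - p * pderiv q) / to_fract (q * q))"

text \<open>The quotient rule for arbitrary representations: differentiate the equation that says that
  two fractions are equal.\<close>

lemma rf_deriv_quot:
  assumes f: "f = to_fract a / to_fract b" and b: "b \<noteq> 0"
  shows "rf_deriv f = to_fract (pderiv a * b - a * pderiv b) / to_fract (b * b)"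
proof -
  define p q where "p = fst (quot_of_fract f)" and "q = snd (quot_of_fract f)"
  have q: "q \<noteq> 0" by (simp add: q_def)
  have eq: "p * b = a * q"
    using rf_quot[of f] f b q to_fract_quot_eq_iff[of q b p a] by (simp add: p_def q_def)
  have eq': "p * pderiv b + b * pderiv p = a * pderiv q + q * pderiv a"
    using arg_cong[OF eq, of pderiv] by (simp add: pderiv_mult algebra_simps)
  have "(pderiv p * q - p * pderiv q) * (b * b) = (b * pderiv p) * q * b - (p * b) * pderiv q * b"
    by (simp add: algebra_simps)
  also have "\<dots> = (b * pderiv p) * q * b - a * q * pderiv q * b" by (simp add: eq)
  also have "b * pderiv p = a * pderiv q + q * pderiv a - p * pderiv b"
    using eq' by (simp add: algebra_simps)
  also have "(a * pderiv q + q * pderiv a - p * pderiv b) * q * b - a * q * pderiv q * b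
     = pderiv a * b * (q * q) - (p * b) * pderiv b * q" by (simp add: algebra_simps)
  also have "\<dots> = (pderiv a * b - a * pderiv b) * (q * q)" by (simp only: eq) (simp add: algebra_simps)
  finally show ?thesis
    using q b to_fract_quot_eq_iff[of "q * q" "b * b"]
    by (simp add: rf_deriv_def Let_def p_def q_def
        del: to_fract_mult to_fract_add to_fract_diff)
qed

lemma rf_deriv_const [simp]: "rf_deriv (rf_const c) = 0"
  using rf_deriv_quot[of "rf_const c" "[:c:]" 1] by (simp add: rf_const_def pderiv_pCons)

lemma rf_deriv_add [simp]: "rf_deriv (f + g) = rf_deriv f + rf_deriv g"
proof -
  obtain p q where f: "f = to_fract p / to_fract q" "q \<noteq> 0"
    by (rule rf_cases[of f])
  obtain p' q' where g: "g = to_fract p' / to_fract q'" "q' \<noteq> 0"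
    by (rule rf_cases[of g])
  have fg: "f + g = to_fract (p * q' + p' * q) / to_fract (q * q')"
    using f(2) g(2) by (simp add: f(1) g(1) add_frac_eq)
  have qq: "q * q' \<noteq> 0" using f(2) g(2) by simp
  have "(pderiv (p * q' + p' * q) * (q * q') - (p * q' + p' * q) * pderiv (q * q')) * (q * q * (q' * q'))
      = ((pderiv p * q - p * pderiv q) * (q' * q') + (pderiv p' * q' - p' * pderiv q') * (q * q)) * ((q * q') * (q * q'))"
    unfolding pderiv_mult pderiv_add by (simp add: algebra_simps)
  then have "rf_deriv (f + g) = to_fract ((pderiv p * q - p * pderiv q) * (q' * q')
      + (pderiv p' * q' - p' * pderiv q') * (q * q)) / to_fract (q * q * (q' * q'))"
    using f(2) g(2) unfolding rf_deriv_quot[OF fg qq]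
    by (simp only: to_fract_quot_eq_iff mult_eq_0_iff simp_thms)
  also have "\<dots> = rf_deriv f + rf_deriv g"
    using f(2) g(2) by (simp add: rf_deriv_quot[OF f] rf_deriv_quot[OF g] add_frac_eq del: to_fract_diff)
  finally show ?thesis .
qed

lemma rf_deriv_mult [simp]: "rf_deriv (f * g) = f * rf_deriv g + g * rf_deriv f"
proof -
  obtain p q where f: "f = to_fract p / to_fract q" "q \<noteq> 0"
    by (rule rf_cases[of f])
  obtain p' q' where g: "g = to_fract p' / to_fract q'" "q' \<noteq> 0"
    by (rule rf_cases[of g])
  have fg: "f * g = to_fract (p * p') / to_fract (q * q')"
    using f(2) g(2) by (simp add: f(1) g(1) add_frac_eq)
  have qq: "q * q' \<noteq> 0" using f(2) g(2) by simp
  have "(pderiv (p * p') * (q * q') - (p * p') * pderiv (q * q')) * (q * q * (q' * q'))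
      = (p * q * (pderiv p' * q' - p' * pderiv q') + (pderiv p * q - p * pderiv q) * (p' * q')) * ((q * q') * (q * q'))"
    unfolding pderiv_mult pderiv_add by (simp add: algebra_simps)
  then have "rf_deriv (f * g) = to_fract (p * q * (pderiv p' * q' - p' * pderiv q')
      + (pderiv p * q - p * pderiv q) * (p' * q')) / to_fract (q * q * (q' * q'))"
    using f(2) g(2) unfolding rf_deriv_quot[OF fg qq]
    by (simp only: to_fract_quot_eq_iff mult_eq_0_iff simp_thms)
  also have "\<dots> = f * rf_deriv g + g * rf_deriv f"
    unfolding rf_deriv_quot[OF f] rf_deriv_quot[OF g]
    unfolding f(1) g(1)
    using f(2) g(2) by (simp add: add_divide_distrib mult.commute mult.left_commute)
  finally show ?thesis .
qed

lemma rf_deriv_0 [simp]: "rf_deriv 0 = 0"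
  using rf_deriv_const[of 0] by (simp del: rf_deriv_const)

lemma rf_deriv_1 [simp]: "rf_deriv 1 = 0"
  using rf_deriv_const[of 1] by (simp del: rf_deriv_const)

lemma rf_deriv_minus [simp]: "rf_deriv (- f) = - rf_deriv f"
  using rf_deriv_add[of f "- f"] by (simp add: eq_neg_iff_add_eq_0 add.commute del: rf_deriv_add)

lemma rf_deriv_diff [simp]: "rf_deriv (f - g) = rf_deriv f - rf_deriv g"
  using rf_deriv_add[of f "-g"] by (simp del: rf_deriv_add)

lemma rf_deriv_sum: "rf_deriv (sum f A) = (\<Sum>i\<in>A. rf_deriv (f i))"
  by (induction A rule: infinite_finite_induct) simp_all

lemma rf_deriv_inverse: "f \<noteq> 0 \<Longrightarrow> rf_deriv (inverse f) = - rf_deriv f / (f * f)"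
proof -
  assume f: "f \<noteq> 0"
  have "f * rf_deriv (inverse f) + inverse f * rf_deriv f = 0"
    using f rf_deriv_mult[of f "inverse f"] by (simp del: rf_deriv_mult)
  then show ?thesis using f by (simp add: field_simps eq_neg_iff_add_eq_0)
qed

lemma rf_deriv_power: "rf_deriv (f ^ k) = of_nat k * f ^ (k - 1) * rf_deriv f"
proof (induction k)
  case (Suc k)
  then show ?case by (cases k) (simp_all add: algebra_simps)
qed simp

lemma rf_deriv_power_int:
  assumes "f \<noteq> 0"
  shows "rf_deriv (f powi k) = of_int k * f powi k * (rf_deriv f / f)"
proof -
  have nat: "rf_deriv (g powi int k) = of_nat k * g powi int k * (rf_deriv g / g)"
    if g: "g \<noteq> 0" for g k
  proof (cases k)
    case (Suc j)
    have "g * (g ^ j * (rf_deriv g / g)) = g ^ j * rf_deriv g" using g by simp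
    then show ?thesis
      using rf_deriv_power[of g k] by (simp only: power_int_of_nat Suc) (simp add: mult.assoc)
  qed simp
  show ?thesis
  proof (cases "k \<ge> 0")
    case True then show ?thesis using nat[OF assms, of "nat k"] by (simp add: of_nat_nat)
  next
    case False
    then obtain m where k: "k = - int m" by (metis int_cases2 nle_le of_nat_0_le_iff)
    have e: "f powi k = inverse f powi int m" by (simp only: k power_int_minus power_int_inverse)
    have "rf_deriv (inverse f) / inverse f = - (rf_deriv f / f)"
      using assms by (simp add: rf_deriv_inverse)
    then show ?thesis
      using nat[of "inverse f" m] assms by (simp only: e) (simp add: k)
  qed
qed

text \<open>In lowest terms \<open>p' q = p q'\<close> forces \<open>q\<close> to divide \<open>q'\<close>, which has smaller degree, so both
  are constant in characteristic zero.\<close>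

lemma rf_deriv_eq_0_iff: "rf_deriv f = 0 \<longleftrightarrow> f \<in> range rf_const"
proof
  assume d: "rf_deriv f = 0"
  obtain p q where f: "f = to_fract p / to_fract q" "q \<noteq> 0" "coprime p q"
    by (rule rf_cases[of f])
  have e: "pderiv p * q = p * pderiv q"
    using d rf_deriv_quot[OF f(1,2)] f(2) by (simp flip: to_fract_mult)
  have "q dvd p * pderiv q" using e by (metis dvd_triv_right)
  then have "q dvd pderiv q"
    using f(3) by (simp add: coprime_dvd_mult_right_iff coprime_commute)
  then have q': "pderiv q = 0"
    using not_dvd_pderiv pderiv_eq_0_iff by blast
  then have "pderiv p = 0" using e f(2) by simp
  with q' obtain a b where "p = [:a:]" "q = [:b:]"
    by (metis degree_eq_zeroE pderiv_eq_0_iff)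
  then have "f = rf_const (a / b)" using f by (simp add: rf_const_def[symmetric])
  then show "f \<in> range rf_const" by blast
qed auto

lemma rf_deriv_regular:
  assumes "rf_regular_at f t" shows "rf_regular_at (rf_deriv f) t"
proof -
  obtain p q where f: "f = to_fract p / to_fract q" "poly q t \<noteq> 0" "q \<noteq> 0"
    using rf_regular_cases[OF assms] by metis
  show ?thesis using rf_eval_quot(1)[OF rf_deriv_quot[OF f(1,3)]] f(2) by simp
qed

section \<open>Orders of zeros and poles\<close>

definition rf_lin :: "complex \<Rightarrow> ratfun" where
  "rf_lin a = to_fract [:-a, 1:]"

lemma rf_lin_nonzero [simp]: "rf_lin a \<noteq> 0"
  by (simp add: rf_lin_def)

lemma rf_deriv_lin [simp]: "rf_deriv (rf_lin a) = 1"
  using rf_deriv_quot[of "rf_lin a" "[:-a, 1:]" 1] by (simp add: rf_lin_def pderiv_pCons flip: one_pCons)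

lemma rf_eval_lin: "rf_regular_at (rf_lin a) t \<and> rf_eval (rf_lin a) t = t - a"
  using rf_eval_quot[of "rf_lin a" "[:-a, 1:]" 1 t] by (simp add: rf_lin_def)

text \<open>The rational function \<open>u\<close> has order \<open>m\<close> at \<open>a\<close>, and \<open>y\<close> is its unit part. Keeping the unit
  part as an argument avoids choosing it.\<close>

definition rf_order_is :: "complex \<Rightarrow> ratfun \<Rightarrow> int \<Rightarrow> ratfun \<Rightarrow> bool" where
  "rf_order_is a u m y \<longleftrightarrow> u = rf_lin a powi m * y \<and> rf_regular_at y a \<and> rf_eval y a \<noteq> 0"

lemma rf_order_quot:
  assumes p: "p \<noteq> 0" and q: "q \<noteq> 0"
  obtains y where
    "rf_order_is a (to_fract p / to_fract q) (int (order a p) - int (order a q)) y"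
proof -
  obtain p' where p': "p = [:-a, 1:] ^ order a p * p'" "\<not> [:-a, 1:] dvd p'"
    using order_decomp[OF p] by blast
  obtain q' where q': "q = [:-a, 1:] ^ order a q * q'" "\<not> [:-a, 1:] dvd q'"
    using order_decomp[OF q] by blast
  have nz: "poly p' a \<noteq> 0" "poly q' a \<noteq> 0"
    using p' q' by (auto simp: poly_eq_0_iff_dvd)
  have pow: "to_fract ([:-a, 1:] ^ k) = rf_lin a ^ k" for k
    by (induction k) (simp_all only: power_0 power_Suc to_fract_1 to_fract_mult rf_lin_def)
  have "to_fract p = rf_lin a ^ order a p * to_fract p'"
    by (subst p'(1)) (simp only: to_fract_mult pow)
  moreover have "to_fract q = rf_lin a ^ order a q * to_fract q'"
    by (subst q'(1)) (simp only: to_fract_mult pow)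
  ultimately have "to_fract p / to_fract q =
      rf_lin a powi (int (order a p) - int (order a q)) * (to_fract p' / to_fract q')"
    by (simp add: power_int_diff)
  then have "rf_order_is a (to_fract p / to_fract q) (int (order a p) - int (order a q))
      (to_fract p' / to_fract q')"
    using rf_eval_quot[of "to_fract p' / to_fract q'" p' q' a] nz by (simp add: rf_order_is_def)
  then show thesis by (rule that)
qed

lemma rf_order_exists:
  assumes "u \<noteq> 0" obtains m y where "rf_order_is a u m y"
proof -
  obtain p q where u: "u = to_fract p / to_fract q" "q \<noteq> 0" by (rule rf_cases)
  then show thesis using assms rf_order_quot[of p q a] that by fastforce
qed

text \<open>Numerator and denominator in lowest terms have no common root, and one of them has a root.\<close>

lemma rf_nonconst_zero_or_pole:
  assumes "u \<notin> range rf_const"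
  obtains a m y where "rf_order_is a u m y" "m \<noteq> 0"
proof -
  obtain p q where u: "u = to_fract p / to_fract q" "q \<noteq> 0" and cop: "coprime p q"
    by (rule rf_cases)
  have "u \<noteq> 0" using assms by (metis rangeI rf_const_hom(1))
  then have p: "p \<noteq> 0" using u by auto
  have "\<not> (degree p = 0 \<and> degree q = 0)"
  proof
    assume "degree p = 0 \<and> degree q = 0"
    then obtain c d where "p = [:c:]" "q = [:d:]" by (meson degree_eq_zeroE)
    then have "u = rf_const (c / d)" using u by (simp add: rf_const_def[symmetric])
    then show False using assms by blast
  qed
  then obtain a where a: "poly p a = 0 \<or> poly q a = 0"
    using fundamental_theorem_of_algebra[of p] fundamental_theorem_of_algebra[of q]
    by (auto simp: constant_degree)
  have "\<not> (poly p a = 0 \<and> poly q a = 0)"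
    using coprime_poly_0[OF cop, of a] by blast
  then have "int (order a p) - int (order a q) \<noteq> 0"
    using a p u(2) order_root[of p a] order_root[of q a] by force
  then show thesis using rf_order_quot[OF p u(2), of a] u(1) that by blast
qed

lemma rf_order_deriv:
  assumes "rf_order_is a u m y"
  shows "rf_lin a * rf_deriv u = rf_lin a powi m * (of_int m * y + rf_lin a * rf_deriv y)"
proof -
  have u: "u = rf_lin a powi m * y" using assms by (simp add: rf_order_is_def)
  show ?thesis
    by (simp add: u rf_deriv_power_int algebra_simps)
qed

text \<open>Leibniz rule for \<open>u = (t - a)\<^bsup>m\<^esup> y\<close>, with the common power of \<open>t - a\<close> cancelled. The factor
  multiplying \<open>w\<close> takes the value \<open>m y(a)\<close> at \<open>a\<close> (\<open>rf_eval_order_deriv\<close>), which is how orders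
  enter.\<close>

lemma rf_order_log_deriv:
  assumes u: "rf_order_is a u m y" and eq: "w * rf_deriv u = f * u"
  shows "w * (of_int m * y + rf_lin a * rf_deriv y) = rf_lin a * (f * y)"
proof -
  have "rf_lin a powi m * (w * (of_int m * y + rf_lin a * rf_deriv y)) =
      rf_lin a * (w * rf_deriv u)"
    by (simp only: rf_order_deriv[OF u, symmetric] mult.left_commute)
  also have "\<dots> = rf_lin a powi m * (rf_lin a * (f * y))"
    unfolding eq using u by (simp add: rf_order_is_def mult_ac)
  finally show ?thesis by simp
qed

lemma rf_eval_order_deriv:
  assumes "rf_order_is a u m y"
  shows "rf_regular_at (of_int m * y + rf_lin a * rf_deriv y) a \<and>
    rf_eval (of_int m * y + rf_lin a * rf_deriv y) a = of_int m * rf_eval y a"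
proof -
  have y: "rf_regular_at y a" using assms by (simp add: rf_order_is_def)
  have "rf_regular_at (rf_const (of_int m) * y) a \<and>
    rf_eval (rf_const (of_int m) * y) a = of_int m * rf_eval y a"
    using rf_eval_mult[OF conjunct1[OF rf_eval_const] y] rf_eval_const by (simp del: rf_const_of_int)
  moreover have "rf_regular_at (rf_lin a * rf_deriv y) a \<and> rf_eval (rf_lin a * rf_deriv y) a = 0"
    using rf_eval_mult[OF conjunct1[OF rf_eval_lin[of a a]] rf_deriv_regular[OF y]] rf_eval_lin[of a a]
    by auto
  ultimately show ?thesis
    using rf_eval_add[of "rf_const (of_int m) * y" a "rf_lin a * rf_deriv y"] by simp
qed

text \<open>The exponential of a nonconstant rational function is not rational. At a zero or pole \<open>a\<close> of
  \<open>u\<close> the logarithmic derivative \<open>u'/u\<close> has a simple pole, but \<open>z'\<close> is regular at \<open>a\<close> or has a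
  pole of order at least two there.\<close>

lemma rf_no_exponential:
  assumes eq: "rf_deriv u = rf_const l * u * rf_deriv z" and l: "l \<noteq> 0"
  shows "u \<in> range rf_const"
proof (rule ccontr)
  assume nc: "u \<notin> range rf_const"
  obtain a m y where u: "rf_order_is a u m y" and m: "m \<noteq> 0"
    using rf_nonconst_zero_or_pole[OF nc] .
  let ?U = "of_int m * y + rf_lin a * rf_deriv y"
  have y: "rf_regular_at y a" "rf_eval y a \<noteq> 0" "u = rf_lin a powi m * y"
    using u by (auto simp: rf_order_is_def)
  have U: "?U = rf_const l * y * (rf_lin a * rf_deriv z)"
    using rf_order_log_deriv[OF u, of 1 "rf_const l * rf_deriv z"] eq by (simp add: mult_ac)
  have evU: "rf_eval ?U a = of_int m * rf_eval y a" "rf_regular_at ?U a"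
    using rf_eval_order_deriv[OF u] by auto
  have ly: "rf_regular_at (rf_const l * y) a \<and> rf_eval (rf_const l * y) a = l * rf_eval y a"
    using rf_eval_mult[OF conjunct1[OF rf_eval_const] y(1)] rf_eval_const by auto
  show False
  proof (cases "rf_regular_at z a")
    case True
    have "rf_eval (rf_lin a * rf_deriv z) a = 0" "rf_regular_at (rf_lin a * rf_deriv z) a"
      using rf_eval_mult[OF conjunct1[OF rf_eval_lin[of a a]] rf_deriv_regular[OF True]]
        rf_eval_lin[of a a] by auto
    then have "rf_eval ?U a = 0" using rf_eval_mult ly unfolding U by (metis mult_zero_right)
    then show False using evU m y(2) by simp
  next
    case False
    then have "z \<noteq> 0" using rf_eval_const[of 0 a] by auto
    then obtain k x where z: "rf_order_is a z k x" by (rule rf_order_exists)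
    then have x: "rf_regular_at x a" "rf_eval x a \<noteq> 0" "z = rf_lin a powi k * x"
      by (auto simp: rf_order_is_def)
    have k: "k < 0"
    proof (rule ccontr)
      assume "\<not> k < 0"
      then have "z = rf_lin a ^ nat k * x" using x(3) by (simp add: power_int_def)
      then show False
        using False rf_eval_mult[OF conjunct1[OF rf_eval_power[OF conjunct1[OF rf_eval_lin]]] x(1)]
        by simp
    qed
    let ?Z = "of_int k * x + rf_lin a * rf_deriv x"
    have evZ: "rf_eval ?Z a = of_int k * rf_eval x a" "rf_regular_at ?Z a"
      using rf_eval_order_deriv[OF z] by auto
    have "rf_lin a powi k * rf_lin a ^ nat (-k) = 1"
      using k power_int_add[of "rf_lin a" k "-k"] by (simp add: power_int_def[of _ "-k"])
    then have "rf_const l * y * ?Z = rf_lin a ^ nat (-k) * ?U"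
      unfolding U rf_order_deriv[OF z] by (simp add: mult_ac)
    moreover have "rf_eval (rf_const l * y * ?Z) a = l * rf_eval y a * (of_int k * rf_eval x a)"
      using rf_eval_mult[OF conjunct1[OF ly] evZ(2)] ly evZ by simp
    moreover have "rf_eval (rf_lin a ^ nat (-k) * ?U) a = 0"
      using rf_eval_mult[OF conjunct1[OF rf_eval_power[OF conjunct1[OF rf_eval_lin]]] evU(2)]
        rf_eval_power[OF conjunct1[OF rf_eval_lin[of a a]], of "nat (-k)"] rf_eval_lin[of a a] k
      by simp
    ultimately show False using l y(2) x(2) k by simp
  qed
qed

text \<open>For eigenvectors \<open>u\<close> and \<open>v\<close> of \<open>w d/dt\<close> the logarithmic derivatives are \<open>l/w\<close> and \<open>k/w\<close>,
  and their residues at \<open>a\<close> are the orders of \<open>u\<close> and \<open>v\<close>. So eigenvalues are proportional to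
  orders.\<close>

lemma rf_eigenvalue_ratio:
  assumes eu: "w * rf_deriv u = rf_const l * u" and ev: "w * rf_deriv v = rf_const k * v"
    and u: "rf_order_is a u m y" and v: "rf_order_is a v n x" and w: "w \<noteq> 0"
  shows "k * of_int m = l * of_int n"
proof -
  let ?U = "of_int m * y + rf_lin a * rf_deriv y" and ?V = "of_int n * x + rf_lin a * rf_deriv x"
  have y: "rf_regular_at y a" "rf_eval y a \<noteq> 0" "u = rf_lin a powi m * y"
    using u by (auto simp: rf_order_is_def)
  have x: "rf_regular_at x a" "rf_eval x a \<noteq> 0" "v = rf_lin a powi n * x"
    using v by (auto simp: rf_order_is_def)
  have U: "w * ?U = rf_lin a * (rf_const l * y)" by (rule rf_order_log_deriv[OF u eu])
  have V: "w * ?V = rf_lin a * (rf_const k * x)" by (rule rf_order_log_deriv[OF v ev])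
  have "(rf_lin a * w) * (rf_const k * x * ?U) = (w * ?U) * (rf_lin a * (rf_const k * x))"
    by (simp only: mult_ac)
  also have "\<dots> = (rf_lin a * (rf_const l * y)) * (w * ?V)" by (simp only: U V)
  also have "\<dots> = (rf_lin a * w) * (rf_const l * y * ?V)" by (simp only: mult_ac)
  finally have "rf_const k * x * ?U = rf_const l * y * ?V" using w by simp
  moreover have "rf_eval (rf_const k * x * ?U) a = k * rf_eval x a * (of_int m * rf_eval y a)"
    using rf_eval_mult[OF conjunct1[OF rf_eval_mult[OF conjunct1[OF rf_eval_const] x(1)]]
        conjunct1[OF rf_eval_order_deriv[OF u]]]
      rf_eval_mult[OF conjunct1[OF rf_eval_const] x(1)] rf_eval_const rf_eval_order_deriv[OF u]
    by simp
  moreover have "rf_eval (rf_const l * y * ?V) a = l * rf_eval y a * (of_int n * rf_eval x a)"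
    using rf_eval_mult[OF conjunct1[OF rf_eval_mult[OF conjunct1[OF rf_eval_const] y(1)]]
        conjunct1[OF rf_eval_order_deriv[OF v]]]
      rf_eval_mult[OF conjunct1[OF rf_eval_const] y(1)] rf_eval_const rf_eval_order_deriv[OF v]
    by simp
  ultimately show ?thesis using x(2) y(2) by simp
qed

section \<open>Linear independence of powers\<close>

text \<open>Multiplying by a power of \<open>y\<close> gives a polynomial with infinitely many roots.\<close>

lemma laurent_zero:
  fixes c :: "int \<Rightarrow> complex"
  assumes M: "finite M" and Y: "infinite Y" "0 \<notin> Y"
    and z: "\<And>y. y \<in> Y \<Longrightarrow> (\<Sum>m\<in>M. c m * y powi m) = 0" and m: "m \<in> M"
  shows "c m = 0"
proof -
  obtain N where N: "\<And>m. m \<in> M \<Longrightarrow> 0 \<le> m + int N"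
  proof
    fix m assume "m \<in> M"
    then have "- m \<le> Max (insert 0 (uminus ` M))" using M by (intro Max_ge) auto
    then show "0 \<le> m + int (nat (Max (insert 0 (uminus ` M))))" by linarith
  qed
  define P where "P = (\<Sum>m\<in>M. monom (c m) (nat (m + int N)))"
  have "poly P y = 0" if y: "y \<in> Y" for y
  proof -
    have "y \<noteq> 0" using y Y by auto
    have "poly P y = (\<Sum>m\<in>M. c m * y powi m * y ^ N)"
      unfolding P_def poly_sum
    proof (rule sum.cong[OF refl])
      fix m assume "m \<in> M"
      then have "y ^ nat (m + int N) = y powi (m + int N)"
        using N by (simp add: power_int_def)
      then show "poly (monom (c m) (nat (m + int N))) y = c m * y powi m * y ^ N"
        using \<open>y \<noteq> 0\<close> by (simp add: poly_monom power_int_add)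
    qed
    also have "\<dots> = 0" using z[OF y] by (simp flip: sum_distrib_right)
    finally show ?thesis .
  qed
  then have "Y \<subseteq> {y. poly P y = 0}" by auto
  then have P0: "P = 0" using poly_roots_finite[of P] Y(1) finite_subset by blast
  have "coeff P (nat (m + int N)) = (\<Sum>j\<in>M. if j = m then c j else 0)"
    unfolding P_def coeff_sum
  proof (rule sum.cong[OF refl])
    fix j assume "j \<in> M"
    then show "coeff (monom (c j) (nat (j + int N))) (nat (m + int N)) = (if j = m then c j else 0)"
      using N[of j] N[OF m] by (auto simp: nat_eq_iff)
  qed
  also have "\<dots> = c m" using M m by (simp add: sum.delta)
  finally show ?thesis using P0 by simp
qed

lemma rf_nonconst_values_infinite:
  assumes r: "r \<notin> range rf_const" and F: "finite F"
  shows "infinite {rf_eval r t | t. t \<notin> F \<and> rf_regular_at r t \<and> rf_eval r t \<noteq> 0}"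
    (is "infinite ?V")
proof
  assume fin: "finite ?V"
  have "UNIV \<subseteq> F \<union> {t. \<not> rf_regular_at r t} \<union>
      (\<Union>y\<in>insert 0 ?V. {t. rf_regular_at r t \<and> rf_eval r t = y})" by auto
  moreover have "finite \<dots>"
    using F fin finite_not_regular rf_nonconst_fibre[OF r] by auto
  ultimately show False using infinite_UNIV_char_0[where 'a=complex] finite_subset by blast
qed

text \<open>A linear relation between powers of \<open>r\<close> holds for all values of \<open>r\<close>, and a nonconstant \<open>r\<close>
  takes infinitely many values.\<close>

lemma rf_powers_independent:
  assumes r: "r \<notin> range rf_const" and M: "finite M"
    and z: "(\<Sum>m\<in>M. rf_const (c m) * r powi m) = 0" and m: "m \<in> M"
  shows "c m = 0"
proof (rule laurent_zero[OF M rf_nonconst_values_infinite[OF r, of "{}"] _ _ m])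
  fix y assume "y \<in> {rf_eval r t |t. t \<notin> {} \<and> rf_regular_at r t \<and> rf_eval r t \<noteq> 0}"
  then obtain t where t: "y = rf_eval r t" "rf_regular_at r t" "rf_eval r t \<noteq> 0" by auto
  have "rf_regular_at (rf_const (c m) * r powi m) t \<and>
      rf_eval (rf_const (c m) * r powi m) t = c m * y powi m" for m
    using rf_eval_mult[OF conjunct1[OF rf_eval_const] conjunct1[OF rf_eval_power_int[OF t(2,3)]]]
      rf_eval_const rf_eval_power_int[OF t(2,3)] t(1) by simp
  then have "rf_eval (\<Sum>m\<in>M. rf_const (c m) * r powi m) t = (\<Sum>m\<in>M. c m * y powi m)"
    using rf_eval_sum[of M "\<lambda>m. rf_const (c m) * r powi m" t] by simp
  then show "(\<Sum>m\<in>M. c m * y powi m) = 0"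
    using z rf_eval_const[of 0 t] by simp
qed auto

section \<open>Polynomials in a rational function\<close>

definition rf_poly :: "complex poly \<Rightarrow> ratfun \<Rightarrow> ratfun" where
  "rf_poly q u = poly (map_poly rf_const q) u"

lemma rf_poly_0 [simp]: "rf_poly 0 u = 0"
  by (simp add: rf_poly_def)

lemma rf_poly_pCons [simp]: "rf_poly (pCons a q) u = rf_const a + u * rf_poly q u"
  by (simp add: rf_poly_def map_poly_pCons)

lemma rf_poly_monom [simp]: "rf_poly (monom a k) u = rf_const a * u ^ k"
  by (simp add: rf_poly_def map_poly_monom poly_monom)

lemma rf_poly_add [simp]: "rf_poly (p + q) u = rf_poly p u + rf_poly q u"
  by (induction p q rule: poly_induct2) (simp_all add: algebra_simps)

lemma rf_poly_smult [simp]: "rf_poly (smult c q) u = rf_const c * rf_poly q u"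
  by (induction q) (simp_all add: algebra_simps)

lemma rf_poly_diff [simp]: "rf_poly (p - q) u = rf_poly p u - rf_poly q u"
  using rf_poly_add[of "p - q" q u] by (simp del: rf_poly_add)

lemma rf_poly_sum: "rf_poly (sum f A) u = (\<Sum>i\<in>A. rf_poly (f i) u)"
  by (induction A rule: infinite_finite_induct) simp_all

lemma rf_eval_poly:
  assumes "rf_regular_at u t"
  shows "rf_regular_at (rf_poly q u) t \<and> rf_eval (rf_poly q u) t = poly q (rf_eval u t)"
proof (induction q)
  case 0 then show ?case using rf_eval_const[of 0 t] by simp
next
  case (pCons a q)
  then have "rf_regular_at (u * rf_poly q u) t \<and>
      rf_eval (u * rf_poly q u) t = rf_eval u t * poly q (rf_eval u t)"
    using rf_eval_mult[OF assms, of "rf_poly q u"] by simp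
  then show ?case using rf_eval_add[of "rf_const a" t "u * rf_poly q u"] rf_eval_const[of a t] by simp
qed

lemma rf_deriv_poly: "rf_deriv (rf_poly q u) = rf_poly (pderiv q) u * rf_deriv u"
  by (induction q) (simp_all add: pderiv_pCons algebra_simps)

lemma rf_poly_eq_0_iff:
  assumes u: "u \<notin> range rf_const"
  shows "rf_poly q u = 0 \<longleftrightarrow> q = 0"
proof
  assume z: "rf_poly q u = 0"
  have "{rf_eval u t | t. t \<notin> {} \<and> rf_regular_at u t \<and> rf_eval u t \<noteq> 0} \<subseteq> {y. poly q y = 0}"
  proof clarify
    fix t assume "rf_regular_at u t"
    from rf_eval_poly[OF this, of q] show "poly q (rf_eval u t) = 0"
      using z rf_eval_const[of 0 t] by simp
  qed
  then show "q = 0"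
    using rf_nonconst_values_infinite[OF u, of "{}"] poly_roots_finite[of q] finite_subset by blast
qed simp

section \<open>Algebraic dependence of two rational functions\<close>

text \<open>A family may repeat vectors; two equal members give the relation with coefficients \<open>1\<close> and
  \<open>-1\<close>.\<close>

lemma (in vector_space) family_dependent:
  assumes I: "finite I" and T: "finite T" and card: "card T < card I" and F: "F ` I \<subseteq> span T"
  shows "\<exists>c. (\<exists>i\<in>I. c i \<noteq> 0) \<and> (\<Sum>i\<in>I. scale (c i) (F i)) = 0"
proof (cases "inj_on F I")
  case False
  then obtain i j where ij: "i \<in> I" "j \<in> I" "i \<noteq> j" "F i = F j" by (auto simp: inj_on_def)
  define c where "c k = (if k = i then 1 else if k = j then -1 else 0 :: 'a)" for k
  have "(\<Sum>k\<in>I. scale (c k) (F k)) = (\<Sum>k\<in>{i, j}. scale (c k) (F k))"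
    using I ij by (intro sum.mono_neutral_right) (auto simp: c_def)
  also have "\<dots> = 0" using ij by (simp add: c_def)
  finally show ?thesis using ij(1) by (intro exI[of _ c]) (auto simp: c_def)
next
  case True
  have "dependent (F ` I)"
  proof (rule ccontr)
    assume "independent (F ` I)"
    then have "card (F ` I) \<le> card T" using independent_span_bound[OF T _ F] by blast
    then show False using card card_image[OF True] by simp
  qed
  then obtain S u where S: "finite S" "S \<subseteq> F ` I" "(\<Sum>v\<in>S. scale (u v) v) = 0" "\<exists>v\<in>S. u v \<noteq> 0"
    by (auto simp: dependent_explicit)
  define c where "c i = (if F i \<in> S then u (F i) else 0)" for i
  have "(\<Sum>i\<in>I. scale (c i) (F i)) = (\<Sum>v\<in>F ` I. scale (if v \<in> S then u v else 0) v)"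
    by (simp add: sum.reindex[OF True] c_def)
  also have "\<dots> = (\<Sum>v\<in>S. scale (u v) v)"
    using I S(2) by (intro sum.mono_neutral_cong_right) auto
  finally show ?thesis using S by (intro exI[of _ c]) (auto simp: c_def image_iff)
qed

interpretation cpoly: vector_space "smult :: complex \<Rightarrow> complex poly \<Rightarrow> complex poly"
  by unfold_locales (simp_all add: smult_add_right smult_add_left)

lemma poly_family_dependent:
  fixes F :: "'i \<Rightarrow> complex poly"
  assumes I: "finite I" and card: "M + 1 < card I" and deg: "\<And>i. i \<in> I \<Longrightarrow> degree (F i) \<le> M"
  shows "\<exists>c. (\<exists>i\<in>I. c i \<noteq> 0) \<and> (\<Sum>i\<in>I. smult (c i) (F i)) = 0"
proof (rule cpoly.family_dependent[OF I])
  let ?T = "(\<lambda>k. monom 1 k) ` {..M}"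
  show "finite ?T" by simp
  have "card ?T \<le> M + 1" using card_image_le[of "{..M}" "monom 1"] by simp
  then show "card ?T < card I" using card by (rule le_less_trans)
  show "F ` I \<subseteq> cpoly.span ?T"
  proof clarify
    fix i assume "i \<in> I"
    then have "F i = (\<Sum>k\<le>M. smult (coeff (F i) k) (monom 1 k))"
      using poly_as_sum_of_monoms'[OF deg] by (simp add: smult_monom)
    also have "\<dots> \<in> cpoly.span ?T"
      by (intro cpoly.span_sum cpoly.span_scale cpoly.span_base) auto
    finally show "F i \<in> cpoly.span ?T" .
  qed
qed

text \<open>A dimension count. After multiplication by a common denominator the \<open>(N + 1)\<^sup>2\<close> monomials of
  degree at most \<open>N\<close> in each of \<open>u\<close> and \<open>v\<close> lie in the space of polynomials of degree at most
  \<open>2 N D\<close>, whose dimension \<open>2 N D + 1\<close> is smaller for \<open>N = 2 D + 1\<close>.\<close>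

lemma rf_algebraic_dependence:
  fixes u v :: ratfun
  shows "\<exists>N p. (\<exists>j\<le>N. p j \<noteq> 0) \<and> (\<Sum>j\<le>N. rf_poly (p j) u * v ^ j) = 0"
proof -
  obtain a b where u: "u = to_fract a / to_fract b" "b \<noteq> 0" by (rule rf_cases)
  obtain c d where v: "v = to_fract c / to_fract d" "d \<noteq> 0" by (rule rf_cases)
  define D where "D = Max {degree a, degree b, degree c, degree d}"
  have D: "degree a \<le> D" "degree b \<le> D" "degree c \<le> D" "degree d \<le> D"
    by (auto simp: D_def)
  define N where "N = 2 * D + 1"
  define I where "I = {..N} \<times> {..N}"
  define F where "F = (\<lambda>(i, j). (a ^ i * b ^ (N - i)) * (c ^ j * d ^ (N - j)))"
  have pw: "degree (x ^ i * y ^ (N - i)) \<le> N * D"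
    if "degree x \<le> D" "degree y \<le> D" "i \<le> N" for x y :: "complex poly" and i
  proof -
    have "degree (x ^ i * y ^ (N - i)) \<le> degree x * i + degree y * (N - i)"
      by (intro order.trans[OF degree_mult_le] add_mono degree_power_le)
    also have "\<dots> \<le> D * i + D * (N - i)" using that by (intro add_mono mult_right_mono) auto
    also have "\<dots> = N * D" using that(3) by (simp flip: distrib_left)
    finally show ?thesis .
  qed
  have deg: "degree (F x) \<le> 2 * N * D" if xI: "x \<in> I" for x
  proof -
    obtain i j where x: "x = (i, j)" "i \<le> N" "j \<le> N" using xI unfolding I_def by blast
    then have "degree (F x) \<le> N * D + N * D"
      by (simp add: F_def) (intro order.trans[OF degree_mult_le] add_mono pw D; simp)
    then show ?thesis by simp
  qed
  have "2 * N * D + 1 < (N + 1) * (N + 1)" by (simp add: N_def algebra_simps)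
  then have card: "2 * N * D + 1 < card I" by (simp add: I_def)
  have finI: "finite I" by (simp add: I_def)
  obtain e where e: "\<exists>x\<in>I. e x \<noteq> 0" "(\<Sum>x\<in>I. smult (e x) (F x)) = 0"
    using poly_family_dependent[OF finI card, of F] deg by auto
  define p where "p j = (\<Sum>i\<le>N. monom (e (i, j)) i)" for j
  \<comment> \<open>The relation between monomials is read as a polynomial in \<open>v\<close> whose coefficients
    \<open>p j\<close> are polynomials in \<open>u\<close>.\<close>
  have cp: "coeff (p j) i = e (i, j)" if "i \<le> N" for i j
    using that by (simp add: p_def coeff_sum)
  have pw': "to_fract (x ^ i) = to_fract x ^ i" for x :: "complex poly" and i
    by (induction i) simp_all
  have frac: "to_fract (x ^ i * y ^ (N - i)) = to_fract y ^ N * (to_fract x / to_fract y) ^ i"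
    if "y \<noteq> 0" "i \<le> N" for x y :: "complex poly" and i
    using that power_diff[of "to_fract y" i N] by (simp add: pw' power_divide)
  have sm: "to_fract (smult k q) = rf_const k * to_fract q" for k q
    by (simp add: rf_const_def flip: to_fract_mult)
  have ts: "to_fract (sum g A) = (\<Sum>x\<in>A. to_fract (g x))" for g :: "'b \<Rightarrow> complex poly" and A
    by (induction A rule: infinite_finite_induct) simp_all
  have "0 = to_fract (\<Sum>x\<in>I. smult (e x) (F x))" using e(2) by simp
  also have "\<dots> = (\<Sum>(i, j)\<in>I. rf_const (e (i, j)) * (to_fract b ^ N * u ^ i * (to_fract d ^ N * v ^ j)))"
    unfolding ts
  proof (rule sum.cong[OF refl], clarify)
    fix i j assume "(i, j) \<in> I"
    then have ij: "i \<le> N" "j \<le> N" by (auto simp: I_def)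
    have "to_fract (F (i, j)) = to_fract (a ^ i * b ^ (N - i)) * to_fract (c ^ j * d ^ (N - j))"
      by (simp only: F_def prod.case to_fract_mult)
    then show "to_fract (smult (e (i, j)) (F (i, j))) =
        rf_const (e (i, j)) * (to_fract b ^ N * u ^ i * (to_fract d ^ N * v ^ j))"
      by (simp only: sm frac[OF u(2) ij(1)] frac[OF v(2) ij(2)] flip: u(1) v(1))
  qed
  also have "\<dots> = to_fract b ^ N * to_fract d ^ N * (\<Sum>(i, j)\<in>I. rf_const (e (i, j)) * u ^ i * v ^ j)"
    by (simp add: sum_distrib_left split_beta mult_ac)
  finally have "(\<Sum>(i, j)\<in>I. rf_const (e (i, j)) * u ^ i * v ^ j) = 0"
    using u(2) v(2) by simp
  also have "(\<Sum>(i, j)\<in>I. rf_const (e (i, j)) * u ^ i * v ^ j) =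
      (\<Sum>j\<le>N. \<Sum>i\<le>N. rf_const (e (i, j)) * u ^ i * v ^ j)"
    unfolding I_def by (subst sum.swap) (simp add: sum.cartesian_product)
  also have "\<dots> = (\<Sum>j\<le>N. rf_poly (p j) u * v ^ j)"
    by (simp add: p_def rf_poly_sum sum_distrib_right)
  finally have "(\<Sum>j\<le>N. rf_poly (p j) u * v ^ j) = 0" .
  moreover have "\<exists>j\<le>N. p j \<noteq> 0"
  proof -
    obtain i j where "i \<le> N" "j \<le> N" "e (i, j) \<noteq> 0" using e(1) by (auto simp: I_def)
    then have "p j \<noteq> 0" using cp[of i j] by auto
    then show ?thesis using \<open>j \<le> N\<close> by blast
  qed
  ultimately show ?thesis by blast
qed

text \<open>In a relation of minimal degree in \<open>v\<close> the partial derivative with respect to \<open>v\<close> cannot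
  vanish at \<open>(u, v)\<close>, since it would be a relation of smaller degree. This is where
  characteristic zero enters.\<close>

lemma rf_separable_relation:
  assumes u: "u \<notin> range rf_const"
  shows "\<exists>N p. (\<Sum>j\<le>N. rf_poly (p j) u * v ^ j) = 0 \<and>
    (\<Sum>j\<le>N. of_nat j * rf_poly (p j) u * v ^ (j - 1)) \<noteq> 0"
proof -
  define R where "R N \<longleftrightarrow> (\<exists>p. (\<exists>j\<le>N. p j \<noteq> 0) \<and> (\<Sum>j\<le>N. rf_poly (p j) u * v ^ j) = 0)" for N
  define N where "N = (LEAST N. R N)"
  have "\<exists>N. R N" using rf_algebraic_dependence[of u v] by (simp add: R_def)
  then have RN: "R N" unfolding N_def by (rule LeastI_ex)
  have least: "\<not> R M" if "M < N" for M using that not_less_Least by (auto simp: N_def)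
  obtain p where p: "\<exists>j\<le>N. p j \<noteq> 0" "(\<Sum>j\<le>N. rf_poly (p j) u * v ^ j) = 0"
    using RN by (auto simp: R_def)
  have "N \<noteq> 0"
  proof
    assume "N = 0"
    then show False using p rf_poly_eq_0_iff[OF u] by simp
  qed
  then obtain M where M: "N = Suc M" using not0_implies_Suc by blast
  have pN: "p N \<noteq> 0"
  proof
    assume "p N = 0"
    then have "R M" unfolding R_def using p M by (intro exI[of _ p]) (auto simp: le_Suc_eq)
    then show False using least M by simp
  qed
  have "(\<Sum>j\<le>N. of_nat j * rf_poly (p j) u * v ^ (j - 1)) =
      (\<Sum>j\<le>M. rf_poly (smult (of_nat (Suc j)) (p (Suc j))) u * v ^ j)"
    unfolding M by (subst sum.atMost_Suc_shift) (simp add: algebra_simps)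
  moreover have "(\<Sum>j\<le>M. rf_poly (smult (of_nat (Suc j)) (p (Suc j))) u * v ^ j) \<noteq> 0"
  proof
    assume "(\<Sum>j\<le>M. rf_poly (smult (of_nat (Suc j)) (p (Suc j))) u * v ^ j) = 0"
    moreover have "\<exists>j\<le>M. smult (of_nat (Suc j)) (p (Suc j)) \<noteq> 0"
      using pN M by (intro exI[of _ M]) (simp del: of_nat_Suc)
    ultimately have "R M" unfolding R_def by (intro exI[of _ "\<lambda>j. smult (of_nat (Suc j)) (p (Suc j))"]) simp
    then show False using least M by simp
  qed
  ultimately have "(\<Sum>j\<le>N. of_nat j * rf_poly (p j) u * v ^ (j - 1)) \<noteq> 0" by (rule ssubst)
  with p(2) show ?thesis by (intro exI[of _ N] exI[of _ p] conjI)
qed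

section \<open>Finite-dimensional spaces stable under a vector field\<close>

definition rf_scale :: "complex \<Rightarrow> ratfun \<Rightarrow> ratfun" where
  "rf_scale c f = rf_const c * f"

interpretation rfv: vector_space rf_scale
  by unfold_locales (simp_all add: rf_scale_def algebra_simps)

lemma rf_eigenvectors_proportional:
  assumes u: "w * rf_deriv u = rf_const l * u" and v: "w * rf_deriv v = rf_const l * v"
    and "w \<noteq> 0" "u \<noteq> 0"
  obtains c where "v = rf_const c * u"
proof -
  have "w * rf_deriv (v * inverse u) =
      v * - (w * rf_deriv u) / (u * u) + inverse u * (w * rf_deriv v)"
    using \<open>u \<noteq> 0\<close> by (simp add: rf_deriv_inverse algebra_simps)
  also have "\<dots> = 0" unfolding u v using \<open>u \<noteq> 0\<close> by (simp add: field_simps)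
  finally have "rf_deriv (v * inverse u) = 0" using \<open>w \<noteq> 0\<close> by (simp del: rf_deriv_mult)
  then obtain c where "v * inverse u = rf_const c" unfolding rf_deriv_eq_0_iff by blast
  then have "v = rf_const c * u" using \<open>u \<noteq> 0\<close> by (simp add: field_simps)
  then show thesis by (rule that)
qed

text \<open>The ratio is a time coordinate of the vector field: along its flow it grows at unit speed.\<close>

lemma rf_generalized_eigenvector_ratio:
  assumes v: "w * rf_deriv v = rf_const l * v + u" and u: "w * rf_deriv u = rf_const l * u"
    and "u \<noteq> 0"
  shows "w * rf_deriv (v / u) = 1"
proof -
  have "w * rf_deriv (v * inverse u) =
      v * - (w * rf_deriv u) / (u * u) + inverse u * (w * rf_deriv v)"
    using \<open>u \<noteq> 0\<close> by (simp add: rf_deriv_inverse algebra_simps)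
  also have "\<dots> = 1" unfolding u v using \<open>u \<noteq> 0\<close> by (simp add: field_simps)
  finally show ?thesis by (simp add: divide_inverse)
qed

text \<open>Induction along a Jordan chain, without the Jordan normal form: by finite dimension every
  element of \<open>V\<close> is annihilated by a nonzero polynomial in \<open>w d/dt\<close>, which splits into linear
  factors; each application of the step removes one factor.\<close>

lemma rf_deriv_stable_induct:
  assumes V: "rfv.subspace V" "\<And>v. v \<in> V \<Longrightarrow> w * rf_deriv v \<in> V"
    and T: "finite T" "V \<subseteq> rfv.span T"
    and P0: "P 0"
    and step: "\<And>l v. v \<in> V \<Longrightarrow> P (w * rf_deriv v - rf_const l * v) \<Longrightarrow> P v"
    and v: "v \<in> V"
  shows "P v"
proof -
  define d where "d = (\<lambda>v. w * rf_deriv v)"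
  have dV: "d v \<in> V" if "v \<in> V" for v using V(2)[OF that] by (simp add: d_def)
  have dk: "(d ^^ i) v \<in> V" if "v \<in> V" for v i by (induction i) (simp_all add: that dV)
  have dd: "d (x - rf_const l * y) = d x - rf_const l * d y" for x y l
    by (simp add: d_def algebra_simps)
  have dlin: "(d ^^ i) (x - rf_const l * y) = (d ^^ i) x - rf_const l * (d ^^ i) y" for i x y l
    by (induction i) (simp_all add: dd)
  have main: "P v" if "v \<in> V" "p \<noteq> 0" "degree p \<le> N"
      "(\<Sum>i\<le>N. rf_const (coeff p i) * (d ^^ i) v) = 0" for N p v
    using that
  proof (induction N arbitrary: p v)
    case 0
    then have "coeff p 0 \<noteq> 0" by (metis le_zero_eq leading_coeff_0_iff)
    then have "v = 0" using 0 by simp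
    then show ?case using P0 by simp
  next
    case (Suc N)
    show ?case
    proof (cases "degree p \<le> N")
      case True
      then have "coeff p (Suc N) = 0" by (simp add: coeff_eq_0)
      then show ?thesis using Suc.IH[OF Suc.prems(1,2) True] Suc.prems(4) by simp
    next
      case False
      then have deg: "degree p = Suc N" using Suc.prems(3) by simp
      then obtain l where "poly p l = 0"
        using fundamental_theorem_of_algebra[of p] by (auto simp: constant_degree)
      then obtain q where pq: "p = [:-l, 1:] * q" by (auto simp: poly_eq_0_iff_dvd elim: dvdE)
      have q: "q \<noteq> 0" using Suc.prems(2) pq by auto
      then have "degree q \<le> N" using deg unfolding pq by (subst (asm) degree_mult_eq) auto
      then have qN: "coeff q (Suc N) = 0" by (simp add: coeff_eq_0)
      have c0: "coeff p 0 = - l * coeff q 0" by (simp add: pq)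
      have cS: "coeff p (Suc i) = coeff q i - l * coeff q (Suc i)" for i
        by (simp add: pq)
      have "0 = (\<Sum>i\<le>Suc N. rf_const (coeff p i) * (d ^^ i) v)" using Suc.prems(4) by simp
      also have "\<dots> = rf_const (coeff p 0) * v +
          (\<Sum>i\<le>N. rf_const (coeff p (Suc i)) * (d ^^ Suc i) v)"
        by (subst sum.atMost_Suc_shift) simp
      also have "\<dots> = (\<Sum>i\<le>N. rf_const (coeff q i) * (d ^^ Suc i) v) - rf_const l *
          (rf_const (coeff q 0) * v + (\<Sum>i\<le>N. rf_const (coeff q (Suc i)) * (d ^^ Suc i) v))"
        unfolding c0 cS by (simp add: algebra_simps sum_subtractf sum_distrib_left del: funpow.simps)
      also have "rf_const (coeff q 0) * v + (\<Sum>i\<le>N. rf_const (coeff q (Suc i)) * (d ^^ Suc i) v) =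
          (\<Sum>i\<le>Suc N. rf_const (coeff q i) * (d ^^ i) v)"
        by (subst sum.atMost_Suc_shift) simp
      also have "\<dots> = (\<Sum>i\<le>N. rf_const (coeff q i) * (d ^^ i) v)" by (simp add: qN)
      also have "(\<Sum>i\<le>N. rf_const (coeff q i) * (d ^^ Suc i) v) - rf_const l * \<dots> =
          (\<Sum>i\<le>N. rf_const (coeff q i) * (d ^^ i) (d v - rf_const l * v))"
        by (simp add: dlin funpow_swap1 right_diff_distrib sum_subtractf sum_distrib_left mult.left_commute)
      finally have "P (d v - rf_const l * v)"
      proof (intro Suc.IH[OF _ q \<open>degree q \<le> N\<close>])
        show "d v - rf_const l * v \<in> V"
          using rfv.subspace_diff[OF V(1) dV rfv.subspace_scale[OF V(1)]] Suc.prems(1)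
          by (simp add: rf_scale_def)
      qed simp
      then show ?thesis using step[OF Suc.prems(1)] by (simp add: d_def)
    qed
  qed
  have "(\<lambda>i. (d ^^ i) v) ` {..card T} \<subseteq> rfv.span T" using dk[OF v] T(2) by auto
  from rfv.family_dependent[OF _ T(1) _ this]
  obtain c where c: "\<exists>i\<le>card T. c i \<noteq> 0" "(\<Sum>i\<le>card T. rf_scale (c i) ((d ^^ i) v)) = 0"
    by auto
  define p where "p = (\<Sum>i\<le>card T. monom (c i) i)"
  have cp: "coeff p i = (if i \<le> card T then c i else 0)" for i
    by (simp add: p_def coeff_sum)
  show ?thesis
  proof (rule main[OF v])
    show "p \<noteq> 0" using c(1) cp by (metis coeff_0)
    show "degree p \<le> card T" by (rule degree_le) (simp add: cp)
    show "(\<Sum>i\<le>card T. rf_const (coeff p i) * (d ^^ i) v) = 0"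
      using c(2) by (simp add: cp rf_scale_def)
  qed
qed

section \<open>Vector fields with a time coordinate\<close>

lemma pderiv_sum: "pderiv (sum f A) = (\<Sum>i\<in>A. pderiv (f i))"
  by (induction A rule: infinite_finite_induct) (simp_all add: pderiv_add)

lemma poly_antiderivative: "\<exists>R. pderiv R = q" for q :: "complex poly"
proof
  define R where "R = (\<Sum>i\<le>degree q. monom (coeff q i / of_nat (Suc i)) (Suc i))"
  have "pderiv R = (\<Sum>i\<le>degree q. monom (coeff q i) i)"
    unfolding R_def pderiv_sum by (simp add: pderiv_monom del: of_nat_Suc)
  then show "pderiv R = q" by (simp add: poly_as_sum_of_monoms)
qed

text \<open>Modulo terms of smaller degree \<open>- q/l\<close> is a solution.\<close>

lemma poly_ode_solvable: "l \<noteq> 0 \<Longrightarrow> \<exists>R. pderiv R - smult l R = q" for q :: "complex poly"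
proof (induction "degree q" arbitrary: q rule: less_induct)
  case less
  define S where "S = smult (- (1 / l)) q"
  show ?case
  proof (cases "degree q = 0")
    case True
    then have "pderiv S = 0" by (simp add: S_def pderiv_smult pderiv_eq_0_iff)
    then have "pderiv S - smult l S = q" using less.prems by (simp add: S_def)
    then show ?thesis by blast
  next
    case False
    then have "degree (- pderiv S) < degree q" by (simp add: S_def pderiv_smult degree_pderiv)
    then obtain R where "pderiv R - smult l R = - pderiv S" using less by blast
    moreover have "- smult l S = q" using less.prems by (simp add: S_def)
    ultimately have "pderiv (R + S) - smult l (R + S) = q"
      by (simp add: pderiv_add smult_add_right algebra_simps)
    then show ?thesis by blast
  qed
qed

text \<open>In the step the equation \<open>(\<delta> - l) v = q(z)\<close> has a particular solution that is a polynomial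
  in \<open>z\<close>. Solutions of the homogeneous equation are constant for \<open>l = 0\<close> and zero for \<open>l \<noteq> 0\<close>,
  since there is no rational exponential of a multiple of \<open>z\<close>.\<close>

lemma rf_translation_case:
  assumes V: "rfv.subspace V" "\<And>v. v \<in> V \<Longrightarrow> w * rf_deriv v \<in> V"
    and T: "finite T" "V \<subseteq> rfv.span T"
    and z: "w * rf_deriv z = 1" and v: "v \<in> V"
  shows "\<exists>q. v = rf_poly q z"
proof (rule rf_deriv_stable_induct[OF V T _ _ v])
  show "\<exists>q. 0 = rf_poly q z" by (rule exI[of _ 0]) simp
next
  fix l v assume "v \<in> V" and "\<exists>q. w * rf_deriv v - rf_const l * v = rf_poly q z"
  then obtain q where q: "w * rf_deriv v - rf_const l * v = rf_poly q z" by blast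
  have w: "w \<noteq> 0" using z by auto
  have dz: "w * rf_deriv (rf_poly R z) = rf_poly (pderiv R) z" for R
    using z by (simp add: rf_deriv_poly mult.left_commute)
  show "\<exists>q. v = rf_poly q z"
  proof (cases "l = 0")
    case True
    obtain R where "pderiv R = q" using poly_antiderivative by blast
    then have "w * rf_deriv (v - rf_poly R z) = 0"
      using q True dz[of R] by (simp add: algebra_simps)
    then have "rf_deriv (v - rf_poly R z) = 0" using w by (simp del: rf_deriv_diff)
    then obtain c where c: "v - rf_poly R z = rf_const c" unfolding rf_deriv_eq_0_iff by blast
    have "v = rf_poly (R + [:c:]) z" unfolding rf_poly_add by (simp flip: c)
    then show ?thesis by blast
  next
    case False
    obtain R where R: "pderiv R - smult l R = q" using poly_ode_solvable[OF False] by blast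
    define u where "u = v - rf_poly R z"
    have u: "w * rf_deriv u = rf_const l * u"
      using q dz[of R] by (simp add: u_def algebra_simps flip: R)
    have "rf_deriv u = rf_deriv z * (w * rf_deriv u)" using z by (simp add: mult_ac)
    also have "\<dots> = rf_const l * u * rf_deriv z" by (simp add: u)
    finally have "u \<in> range rf_const" using False by (rule rf_no_exponential)
    then have "rf_deriv u = 0" by (simp add: rf_deriv_eq_0_iff)
    then have "u = 0" using u False by simp
    then show ?thesis by (auto simp: u_def)
  qed
qed

text \<open>On polynomials in \<open>z\<close> the vector field is differentiation, so \<open>V\<close> contains polynomials of
  all smaller degrees as well.\<close>

lemma rf_translation_powers:
  assumes V: "rfv.subspace V" "\<And>v. v \<in> V \<Longrightarrow> w * rf_deriv v \<in> V"
    and z: "w * rf_deriv z = 1"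
  shows "rf_poly q z \<in> V \<Longrightarrow> q \<noteq> 0 \<Longrightarrow> k \<le> degree q \<Longrightarrow> z ^ k \<in> V"
proof (induction "degree q" arbitrary: q k)
  case 0
  then obtain a where "q = [:a:]" by (metis degree_eq_zeroE)
  then have "rf_scale (1 / a) (rf_poly q z) = 1" using 0 by (simp add: rf_scale_def)
  then show ?case using rfv.subspace_scale[OF V(1) 0(2), of "1 / a"] 0 by simp
next
  case (Suc m)
  have "w * rf_deriv (rf_poly q z) = rf_poly (pderiv q) z * (w * rf_deriv z)"
    by (simp add: rf_deriv_poly mult_ac)
  then have "rf_poly (pderiv q) z \<in> V" using V(2)[OF Suc.prems(1)] z by simp
  moreover have "degree (pderiv q) = m" "pderiv q \<noteq> 0"
    using Suc.hyps(2) by (simp_all add: degree_pderiv pderiv_eq_0_iff)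
  ultimately have low: "z ^ j \<in> V" if "j \<le> m" for j using Suc.hyps(1)[of "pderiv q"] that by simp
  show ?case
  proof (cases "k \<le> m")
    case False
    then have k: "k = Suc m" using Suc by simp
    have "rf_poly q z = rf_poly (\<Sum>i\<le>Suc m. monom (coeff q i) i) z"
      using poly_as_sum_of_monoms[of q] by (simp only: Suc.hyps(2))
    also have "\<dots> = (\<Sum>i\<le>m. rf_scale (coeff q i) (z ^ i)) + rf_scale (coeff q k) (z ^ k)"
      by (simp add: rf_poly_sum rf_scale_def k)
    finally have "rf_scale (coeff q k) (z ^ k) = rf_poly q z - (\<Sum>i\<le>m. rf_scale (coeff q i) (z ^ i))"
      by simp
    also have "\<dots> \<in> V"
      using low by (intro rfv.subspace_diff V(1) Suc.prems(1) rfv.subspace_sum rfv.subspace_scale) auto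
    finally have "rf_scale (1 / coeff q k) (rf_scale (coeff q k) (z ^ k)) \<in> V"
      by (rule rfv.subspace_scale[OF V(1)])
    moreover have "coeff q k \<noteq> 0" using Suc.hyps(2) Suc.prems(2) k by (metis leading_coeff_0_iff)
    ultimately show ?thesis by (simp add: rfv.scale_scale) 
  qed (rule low)
qed

text \<open>The degrees of the polynomials in \<open>z\<close> that lie in \<open>V\<close> must reach \<open>n - 1\<close>, where \<open>n\<close> is the
  dimension of \<open>V\<close>, since otherwise fewer than \<open>n\<close> powers of \<open>z\<close> would span \<open>V\<close>.\<close>

lemma rf_translation_exponents:
  assumes V: "rfv.subspace V" "\<And>v. v \<in> V \<Longrightarrow> w * rf_deriv v \<in> V"
    and B: "finite B" "V = rfv.span B" "rfv.independent B" "card B \<ge> 2"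
    and z: "w * rf_deriv z = 1"
  shows "\<exists>r E. r \<notin> range rf_const \<and> finite E \<and> card E = card B \<and> Gcd E = 1 \<and> (\<forall>e\<in>E. r powi e \<in> V)"
proof -
  have nc: "z \<notin> range rf_const" using z rf_deriv_eq_0_iff[of z] by auto
  have "\<exists>q. rf_poly q z \<in> V \<and> q \<noteq> 0 \<and> card B - 1 \<le> degree q"
  proof (rule ccontr)
    assume no: "\<not> ?thesis"
    have "V \<subseteq> rfv.span ((\<lambda>k. z ^ k) ` {..<card B - 1})"
    proof
      fix v assume v: "v \<in> V"
      then obtain q where q: "v = rf_poly q z"
        using rf_translation_case[OF V B(1) _ z] B(2) by blast
      show "v \<in> rfv.span ((\<lambda>k. z ^ k) ` {..<card B - 1})"
      proof (cases "q = 0")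
        case False
        then have deg: "degree q < card B - 1" using no v q by auto
        have "rf_poly q z = rf_poly (\<Sum>i\<le>degree q. monom (coeff q i) i) z"
          by (simp only: poly_as_sum_of_monoms)
        also have "\<dots> = (\<Sum>i\<le>degree q. rf_scale (coeff q i) (z ^ i))"
          by (simp add: rf_poly_sum rf_scale_def)
        also have "\<dots> \<in> rfv.span ((\<lambda>k. z ^ k) ` {..<card B - 1})"
          using deg by (intro rfv.span_sum rfv.span_scale rfv.span_base) auto
        finally show ?thesis by (simp add: q)
      qed (simp add: q rfv.span_zero)
    qed
    then have "card B \<le> card ((\<lambda>k. z ^ k) ` {..<card B - 1})"
      using rfv.independent_span_bound[OF _ B(3)] rfv.span_superset[of B] B(2) by blast
    also have "\<dots> \<le> card B - 1" using card_image_le[of "{..<card B - 1}"] by simp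
    finally show False using B(4) by simp
  qed
  then have pow: "z ^ k \<in> V" if "k < card B" for k
    using rf_translation_powers[OF V z] that by fastforce
  let ?E = "int ` {..<card B}"
  have "1 \<in> ?E" using B(4) by (intro image_eqI[of _ _ 1]) auto
  then have "Gcd ?E dvd 1" by (rule Gcd_dvd)
  then have "Gcd ?E = 1" using Gcd_int_greater_eq_0[of ?E] by simp
  moreover have "card ?E = card B" by (simp add: card_image)
  moreover have "\<forall>e\<in>?E. z powi e \<in> V" using pow by auto
  ultimately show ?thesis using nc by blast
qed

section \<open>Vector fields without a time coordinate\<close>

lemma bezout_Gcd_int:
  fixes m :: "'i \<Rightarrow> int"
  assumes "finite I" shows "\<exists>a. (\<Sum>i\<in>I. a i * m i) = Gcd (m ` I)"
  using assms
proof (induction I)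
  case (insert x F)
  then obtain a where a: "(\<Sum>i\<in>F. a i * m i) = Gcd (m ` F)" by blast
  obtain s t where st: "s * m x + t * Gcd (m ` F) = gcd (m x) (Gcd (m ` F))"
    using bezout_int by blast
  define b where "b i = (if i = x then s else t * a i)" for i
  have "(\<Sum>i\<in>insert x F. b i * m i) = s * m x + (\<Sum>i\<in>F. b i * m i)"
    using insert by (simp add: b_def)
  also have "(\<Sum>i\<in>F. b i * m i) = (\<Sum>i\<in>F. t * (a i * m i))"
    using insert(2) by (intro sum.cong) (auto simp: b_def)
  also have "\<dots> = t * Gcd (m ` F)" by (simp add: a flip: sum_distrib_left)
  finally show ?case using st by (intro exI[of _ b]) simp
qed simp

lemma rf_eigenvector_prod:
  assumes "finite I" "\<And>i. i \<in> I \<Longrightarrow> u i \<noteq> 0 \<and> w * rf_deriv (u i) = rf_const (l i) * u i"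
  shows "w * rf_deriv (\<Prod>i\<in>I. u i powi a i) = rf_const (\<Sum>i\<in>I. of_int (a i) * l i) * (\<Prod>i\<in>I. u i powi a i)"
  using assms
proof (induction I)
  case (insert x F)
  have ux: "w * rf_deriv (u x) = rf_const (l x) * u x" "u x \<noteq> 0" using insert by auto
  have "w * rf_deriv (u x powi a x) = of_int (a x) * u x powi a x * ((w * rf_deriv (u x)) / u x)"
    by (simp add: rf_deriv_power_int[OF ux(2)])
  also have "\<dots> = rf_const (of_int (a x) * l x) * u x powi a x"
    unfolding ux(1) using ux(2) by simp
  finally have x: "w * rf_deriv (u x powi a x) = \<dots>" .
  have F: "w * rf_deriv (\<Prod>i\<in>F. u i powi a i) =
      rf_const (\<Sum>i\<in>F. of_int (a i) * l i) * (\<Prod>i\<in>F. u i powi a i)"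
    using insert by blast
  have "w * rf_deriv (\<Prod>i\<in>insert x F. u i powi a i) =
      u x powi a x * (w * rf_deriv (\<Prod>i\<in>F. u i powi a i)) +
      (\<Prod>i\<in>F. u i powi a i) * (w * rf_deriv (u x powi a x))"
    using insert by (simp add: algebra_simps)
  also have "\<dots> = rf_const (\<Sum>i\<in>insert x F. of_int (a i) * l i) * (\<Prod>i\<in>insert x F. u i powi a i)"
    unfolding x F using insert by (simp add: algebra_simps)
  finally show ?case .
qed simp

text \<open>If \<open>(\<delta> - l) v\<close> is a sum of eigenvectors, those with eigenvalue \<open>m \<noteq> l\<close> can be removed from
  it by subtracting \<open>1/(m - l)\<close> times them from \<open>v\<close>. What remains is an eigenvector \<open>y\<close> for
  \<open>l\<close>, and \<open>y \<noteq> 0\<close> would give a time coordinate.\<close>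

lemma rf_diagonalizable:
  assumes V: "rfv.subspace V" "\<And>v. v \<in> V \<Longrightarrow> w * rf_deriv v \<in> V"
    and T: "finite T" "V \<subseteq> rfv.span T" and w: "w \<noteq> 0"
    and no_z: "\<And>z. w * rf_deriv z \<noteq> 1"
    and u: "\<And>l. l \<in> L \<Longrightarrow> u l \<in> V \<and> u l \<noteq> 0 \<and> w * rf_deriv (u l) = rf_const l * u l"
    and L: "\<And>l v. v \<in> V \<Longrightarrow> v \<noteq> 0 \<Longrightarrow> w * rf_deriv v = rf_const l * v \<Longrightarrow> l \<in> L"
    and v: "v \<in> V"
  shows "v \<in> rfv.span (u ` L)"
proof (rule rf_deriv_stable_induct[OF V T _ _ v])
  show "0 \<in> rfv.span (u ` L)" by (rule rfv.span_zero)
next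
  fix l v assume v: "v \<in> V" and "w * rf_deriv v - rf_const l * v \<in> rfv.span (u ` L)"
  let ?W = "rfv.span (u ` L)"
  \<comment> \<open>The set \<open>S\<close> consists of the vectors that \<open>\<delta> - l\<close> reaches from \<open>?W\<close> up to an
    eigenvector \<open>y\<close> for \<open>l\<close>. It is a subspace containing all \<open>u m\<close>, hence all of \<open>?W\<close>.\<close>
  define S where "S = {x. \<exists>a\<in>?W. \<exists>y. w * rf_deriv y = rf_const l * y \<and>
      w * rf_deriv a - rf_const l * a + y = x}"
  have "rfv.subspace S"
  proof (rule rfv.subspaceI)
    show "0 \<in> S" unfolding S_def by (auto intro!: bexI[of _ 0] rfv.span_zero)
  next
    fix x x' assume "x \<in> S" "x' \<in> S"
    then obtain a y a' y' where *: "a \<in> ?W" "w * rf_deriv y = rf_const l * y"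
        "w * rf_deriv a - rf_const l * a + y = x" "a' \<in> ?W" "w * rf_deriv y' = rf_const l * y'"
        "w * rf_deriv a' - rf_const l * a' + y' = x'" by (auto simp: S_def)
    have "w * rf_deriv (a + a') - rf_const l * (a + a') + (y + y') = x + x'"
      by (simp add: algebra_simps flip: *(3,6))
    moreover have "w * rf_deriv (y + y') = rf_const l * (y + y')"
      using *(2,5) by (simp add: distrib_left)
    ultimately show "x + x' \<in> S" unfolding S_def
      using rfv.span_add[OF *(1,4)] by blast
  next
    fix c x assume "x \<in> S"
    then obtain a y where *: "a \<in> ?W" "w * rf_deriv y = rf_const l * y"
        "w * rf_deriv a - rf_const l * a + y = x" by (auto simp: S_def)
    have "w * rf_deriv (rf_const c * y) = rf_const l * (rf_const c * y)"
      using *(2) by (simp add: mult.left_commute)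
    moreover have "w * rf_deriv (rf_const c * a) - rf_const l * (rf_const c * a) + rf_const c * y = rf_const c * x"
      by (simp add: algebra_simps flip: *(3))
    moreover have "rf_const c * a \<in> ?W"
      using rfv.span_scale[OF *(1), of c] by (simp add: rf_scale_def)
    ultimately have "rf_const c * x \<in> S" unfolding S_def by blast
    then show "rf_scale c x \<in> S" by (simp add: rf_scale_def)
  qed
  moreover have "u ` L \<subseteq> S"
  proof clarify
    fix m assume m: "m \<in> L"
    then have um: "w * rf_deriv (u m) = rf_const m * u m" using u by blast
    show "u m \<in> S"
    proof (cases "m = l")
      case True
      then show ?thesis unfolding S_def
        using um by (intro CollectI bexI[of _ 0] exI[of _ "u m"]) (auto intro: rfv.span_zero)
    next
      case False
      define b where "b = 1 / (m - l)"
      have "rf_const m * rf_const b - rf_const l * rf_const b = rf_const ((m - l) * b)"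
        by (simp add: algebra_simps)
      then have b: "rf_const m * rf_const b - rf_const l * rf_const b = 1"
        using False by (simp add: b_def del: rf_const_divide)
      let ?a = "rf_scale b (u m)"
      have "w * rf_deriv ?a = rf_const b * (w * rf_deriv (u m))"
        by (simp add: rf_scale_def mult.left_commute)
      then have "w * rf_deriv ?a - rf_const l * ?a + 0 =
          (rf_const m * rf_const b - rf_const l * rf_const b) * u m"
        unfolding um by (simp add: rf_scale_def algebra_simps)
      then have "w * rf_deriv ?a - rf_const l * ?a + 0 = u m" by (simp add: b)
      moreover have "?a \<in> ?W" using m by (intro rfv.span_scale rfv.span_base) auto
      ultimately show ?thesis unfolding S_def
        by (intro CollectI bexI[of _ ?a] exI[of _ 0]) auto
    qed
  qed
  ultimately have "?W \<subseteq> S" using rfv.span_minimal by blast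
  then obtain a y where a: "a \<in> ?W" and y: "w * rf_deriv y = rf_const l * y"
    and ay: "w * rf_deriv a - rf_const l * a + y = w * rf_deriv v - rf_const l * v"
    using \<open>w * rf_deriv v - rf_const l * v \<in> ?W\<close> unfolding S_def by blast
  have gen: "w * rf_deriv (v - a) = rf_const l * (v - a) + y"
    using ay by (simp add: algebra_simps)
  have "y = 0" using rf_generalized_eigenvector_ratio[OF gen y] no_z by blast
  then have eig: "w * rf_deriv (v - a) = rf_const l * (v - a)" using gen by simp
  have "u ` L \<subseteq> V" using u by blast
  then have "?W \<subseteq> V" using rfv.span_minimal V(1) by blast
  then have "v - a \<in> V" using a v rfv.subspace_diff[OF V(1)] by blast
  have "v - a \<in> ?W"
  proof (cases "v - a = 0")
    case False
    then have l: "l \<in> L" using L[OF \<open>v - a \<in> V\<close> _ eig] by blast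
    obtain c where "v - a = rf_const c * u l"
      using rf_eigenvectors_proportional[OF _ eig w, of "u l"] u[OF l] by blast
    then show ?thesis using l by (auto simp flip: rf_scale_def intro: rfv.span_scale rfv.span_base)
  qed (simp add: rfv.span_zero)
  then show "v \<in> ?W" using rfv.span_add[OF _ a, of "v - a"] by simp
qed

text \<open>Fix a nonconstant eigenvector and one of its zeros or poles, of order \<open>n\<close> say. Orders at
  that point turn the eigenvalues into integers \<open>m\<close>, which are divided by their greatest
  common divisor \<open>G\<close> to give the exponents. Eigenvectors with the same eigenvalue are
  proportional, so it suffices that \<open>r\<close> has the eigenvalue \<open>c\<close> of exponent one.\<close>

lemma rf_torus_exponents:
  assumes V: "rfv.subspace V" "\<And>v. v \<in> V \<Longrightarrow> w * rf_deriv v \<in> V"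
    and B: "finite B" "V = rfv.span B" "rfv.independent B" "card B \<ge> 2"
    and w: "w \<noteq> 0" and no_z: "\<And>z. w * rf_deriv z \<noteq> 1"
  shows "\<exists>r E. r \<notin> range rf_const \<and> finite E \<and> card E = card B \<and> Gcd E = 1 \<and> (\<forall>e\<in>E. r powi e \<in> V)"
proof -
  define L where "L = {l. \<exists>v\<in>V. v \<noteq> 0 \<and> w * rf_deriv v = rf_const l * v}"
  define u where "u l = (SOME v. v \<in> V \<and> v \<noteq> 0 \<and> w * rf_deriv v = rf_const l * v)" for l
  have u: "u l \<in> V \<and> u l \<noteq> 0 \<and> w * rf_deriv (u l) = rf_const l * u l" if l: "l \<in> L" for l
  proof -
    have "\<exists>v. v \<in> V \<and> v \<noteq> 0 \<and> w * rf_deriv v = rf_const l * v" using l by (auto simp: L_def)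
    then show ?thesis unfolding u_def by (rule someI_ex)
  qed
  have "V \<subseteq> rfv.span B" by (simp add: B(2))
  have "V \<subseteq> rfv.span (u ` L)"
  proof
    fix v assume v: "v \<in> V"
    show "v \<in> rfv.span (u ` L)"
    proof (rule rf_diagonalizable[OF V B(1) \<open>V \<subseteq> rfv.span B\<close> w no_z u _ v])
      fix l v assume "v \<in> V" "v \<noteq> 0" "w * rf_deriv v = rf_const l * v"
      then show "l \<in> L" unfolding L_def by blast
    qed
  qed
  then have "finite L \<Longrightarrow> card B \<le> card (u ` L)"
    using rfv.independent_span_bound[OF _ B(3)] rfv.span_superset[of B] B(2) by blast
  then have "finite L \<Longrightarrow> card B \<le> card L" using card_image_le[of L u] by linarith
  then obtain M where M: "M \<subseteq> L" "finite M" "card M = card B"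
    by (metis infinite_arbitrarily_large obtain_subset_with_card_n)
  have "\<not> M \<subseteq> {0}" using card_mono[of "{0::complex}" M] M(3) B(4) by auto
  then obtain k where k: "k \<in> M" "k \<noteq> 0" by blast
  have "rf_deriv (u k) \<noteq> 0" using u[of k] k M(1) by auto
  then have "u k \<notin> range rf_const" by (simp add: rf_deriv_eq_0_iff)
  then obtain a n y where n: "rf_order_is a (u k) n y" "n \<noteq> 0"
    by (rule rf_nonconst_zero_or_pole)
  have "\<exists>m. l * of_int n = k * of_int m" if "l \<in> M" for l
  proof -
    obtain m x where "rf_order_is a (u l) m x" using rf_order_exists u M(1) \<open>l \<in> M\<close> by blast
    then show ?thesis
      using rf_eigenvalue_ratio[OF _ _ n(1) _ w] u M(1) \<open>l \<in> M\<close> k(1) by blast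
  qed
  then obtain m where m: "\<And>l. l \<in> M \<Longrightarrow> l * of_int n = k * of_int (m l)" by metis
  define G where "G = Gcd (m ` M)"
  have mk: "m k = n" using m[OF k(1)] k(2) by simp
  have G: "G \<noteq> 0" unfolding G_def using k(1) mk n(2) by auto
  obtain b where b: "(\<Sum>l\<in>M. b l * m l) = G" using bezout_Gcd_int[OF M(2)] unfolding G_def by blast
  \<comment> \<open>The eigenvalue \<open>l\<close> is \<open>(k/n) m(l)\<close>, so \<open>c = k G / n\<close> makes it \<open>c e(l)\<close>.\<close>
  define e where "e l = m l div G" for l
  have e: "m l = G * e l" if "l \<in> M" for l
    using that by (simp add: e_def G_def Gcd_dvd)
  define c where "c = k * of_int G / of_int n"
  have ce: "l = c * of_int (e l)" if "l \<in> M" for l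
    using m[OF that] e[OF that] n(2) by (simp add: c_def field_simps)
  have be: "(\<Sum>l\<in>M. b l * e l) = 1"
  proof -
    have "G * (\<Sum>l\<in>M. b l * e l) = (\<Sum>l\<in>M. b l * m l)"
      by (simp add: sum_distrib_left e mult.left_commute)
    then show ?thesis using b G by simp
  qed
  define r where "r = (\<Prod>l\<in>M. u l powi b l)"
  have "r \<noteq> 0" using u M by (auto simp: r_def)
  have "w * rf_deriv r = rf_const (\<Sum>l\<in>M. of_int (b l) * l) * r"
    unfolding r_def using u M by (intro rf_eigenvector_prod) auto
  also have "(\<Sum>l\<in>M. of_int (b l) * l) = (\<Sum>l\<in>M. of_int (b l) * (c * of_int (e l)))"
    using ce by (intro sum.cong) auto
  also have "\<dots> = c * of_int (\<Sum>l\<in>M. b l * e l)" by (simp add: sum_distrib_left mult_ac)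
  finally have r: "w * rf_deriv r = rf_const c * r" by (simp add: be)
  have c0: "c \<noteq> 0" using k(2) G n(2) by (simp add: c_def)
  have "rf_deriv r \<noteq> 0" using r c0 \<open>r \<noteq> 0\<close> by auto
  then have nc: "r \<notin> range rf_const" by (simp add: rf_deriv_eq_0_iff)
  have pow: "r powi e l \<in> V" if l: "l \<in> M" for l
  proof -
    have "w * rf_deriv (r powi e l) = of_int (e l) * r powi e l * ((w * rf_deriv r) / r)"
      using \<open>r \<noteq> 0\<close> by (simp add: rf_deriv_power_int)
    also have "\<dots> = rf_const (c * of_int (e l)) * r powi e l"
      unfolding r using \<open>r \<noteq> 0\<close> by simp
    finally have eig: "w * rf_deriv (r powi e l) = rf_const l * r powi e l" using ce[OF l] by simp
    have ul: "u l \<in> V" "u l \<noteq> 0" "w * rf_deriv (u l) = rf_const l * u l"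
      using u l M(1) by auto
    obtain x where "r powi e l = rf_const x * u l"
      using rf_eigenvectors_proportional[OF ul(3) eig w ul(2)] .
    then show ?thesis using rfv.subspace_scale[OF V(1) ul(1), of x] by (simp add: rf_scale_def)
  qed
  have "inj_on e M" using ce by (metis inj_onI)
  then have "card (e ` M) = card B" using M(3) by (simp add: card_image)
  moreover have "Gcd (e ` M) dvd (\<Sum>l\<in>M. b l * e l)" by (intro dvd_sum dvd_mult Gcd_dvd) auto
  then have "Gcd (e ` M) = 1" using Gcd_int_greater_eq_0[of "e ` M"] by (simp add: be)
  ultimately show ?thesis using nc M(2) pow by (intro exI[of _ r] exI[of _ "e ` M"]) auto
qed

section \<open>Polynomial functions and infinitesimal symmetries\<close>

lemma polyfun_sum: "(\<And>i. i \<in> A \<Longrightarrow> polyfun C (f i)) \<Longrightarrow> polyfun C (\<lambda>x. \<Sum>i\<in>A. f i x)"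
  by (induction A rule: infinite_finite_induct) (auto intro: polyfun.intros)

lemma polyfun_power: "polyfun C f \<Longrightarrow> polyfun C (\<lambda>x. f x ^ k)"
  by (induction k) (auto intro: polyfun.intros)

lemma polyfun_poly: "polyfun C f \<Longrightarrow> polyfun C (\<lambda>x. poly q (f x))"
  by (induction q) (auto intro: polyfun.intros)

lemma polyfun_vec_nth: "polyfun vec_coords (\<lambda>v. v $ i)"
  by (rule polyfun.coord) (auto simp: vec_coords_def)

lemma polyfun_mat_nth: "polyfun mat_coords (\<lambda>A. A $ i $ j)"
  by (rule polyfun.coord) (auto simp: mat_coords_def)

lemma polyfun_compose:
  fixes F :: "'a \<Rightarrow> complex ^ 'n"
  assumes "polyfun vec_coords p" "\<And>i. polyfun C (\<lambda>x. F x $ i)"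
  shows "polyfun C (\<lambda>x. p (F x))"
  using assms(1)
proof induction
  case (coord p)
  then show ?case using assms(2) by (auto simp: vec_coords_def)
qed (auto intro: polyfun.intros)

lemma polyfun_matrix_left: "polyfun vec_coords p \<Longrightarrow> polyfun vec_coords (\<lambda>x. p (g *v x))"
  by (erule polyfun_compose)
    (auto simp: matrix_vector_mult_def intro!: polyfun_sum polyfun.intros(1,4) polyfun_vec_nth)

lemma polyfun_matrix_right: "polyfun vec_coords p \<Longrightarrow> polyfun mat_coords (\<lambda>g. p (g *v x))"
  by (erule polyfun_compose)
    (auto simp: matrix_vector_mult_def intro!: polyfun_sum polyfun.intros(1,4) polyfun_mat_nth)

lemma zariski_closure_superset: "S \<subseteq> zariski_closure S"
  by (auto simp: zariski_closure_def)

lemma zariski_closure_vanish: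
  "polyfun vec_coords p \<Longrightarrow> (\<And>x. x \<in> S \<Longrightarrow> p x = 0) \<Longrightarrow> x \<in> zariski_closure S \<Longrightarrow> p x = 0"
  by (auto simp: zariski_closure_def)

lemma zariski_closure_eqI:
  assumes "\<And>p. polyfun vec_coords p \<Longrightarrow> (\<forall>x\<in>S. p x = 0) \<longleftrightarrow> (\<forall>x\<in>T. p x = 0)"
  shows "zariski_closure S = zariski_closure T"
  using assms by (auto simp: zariski_closure_def)

text \<open>A polynomial \<open>p\<close> vanishing on \<open>X\<close> and a point \<open>x\<close> of \<open>X\<close> give the polynomial \<open>h \<mapsto> p(h x)\<close> on
  matrices, which vanishes on the symmetry group.\<close>

lemma lie_algebra_tangent:
  assumes A: "A \<in> lie_algebra (linear_symmetries X)" and p: "polyfun vec_coords p"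
    and van: "\<And>x. x \<in> X \<Longrightarrow> p x = 0" and x: "x \<in> X"
  shows "((\<lambda>s. p (x + s *s (A *v x))) has_field_derivative 0) (at 0)"
proof -
  have "\<forall>h\<in>linear_symmetries X. p (h *v x) = 0"
    using x van by (auto simp: linear_symmetries_def)
  then have "((\<lambda>s. p ((mat 1 + mat_scale s A) *v x)) has_field_derivative 0) (at 0)"
    using A polyfun_matrix_right[OF p, of x] unfolding lie_algebra_def by blast
  moreover have "(mat 1 + mat_scale s A) *v x = x + s *s (A *v x)" for s
    unfolding matrix_vector_mult_add_rdistrib matrix_vector_mul_lid
    by (simp add: vec_eq_iff mat_scale_def matrix_vector_mult_def sum_distrib_left mult.assoc)
  ultimately show ?thesis by simp
qed

section \<open>Points on the image of a rational map\<close>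

text \<open>Regularity and value in one predicate, so that the value of a composite expression is found
  by applying introduction rules.\<close>

definition rf_value :: "ratfun \<Rightarrow> complex \<Rightarrow> complex \<Rightarrow> bool" where
  "rf_value f t c \<longleftrightarrow> rf_regular_at f t \<and> rf_eval f t = c"

lemma rf_value_intros:
  "rf_value (rf_const c) t c"
  "rf_value (of_nat k) t (of_nat k)"
  "rf_value f t a \<Longrightarrow> rf_value g t b \<Longrightarrow> rf_value (f + g) t (a + b)"
  "rf_value f t a \<Longrightarrow> rf_value g t b \<Longrightarrow> rf_value (f * g) t (a * b)"
  "rf_value f t a \<Longrightarrow> rf_value (f ^ k) t (a ^ k)"
  "rf_value f t a \<Longrightarrow> rf_value (rf_poly q f) t (poly q a)"
  using rf_eval_const rf_eval_const[of "of_nat k" t] rf_eval_add rf_eval_mult rf_eval_power rf_eval_poly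
  by (auto simp: rf_value_def)

lemma rf_value_sum:
  "(\<And>i. i \<in> A \<Longrightarrow> rf_value (f i) t (c i)) \<Longrightarrow> rf_value (sum f A) t (\<Sum>i\<in>A. c i)"
  using rf_eval_sum[of A f t] by (auto simp: rf_value_def)

lemma rf_value_powi: "rf_value f t a \<Longrightarrow> a \<noteq> 0 \<Longrightarrow> rf_value (f powi k) t (a powi k)"
  using rf_eval_power_int by (auto simp: rf_value_def)

lemma rf_value_unique: "rf_value f t a \<Longrightarrow> rf_value f t b \<Longrightarrow> a = b"
  by (simp add: rf_value_def)

lemma rf_value_zero: "infinite T \<Longrightarrow> (\<And>t. t \<in> T \<Longrightarrow> rf_value f t 0) \<Longrightarrow> f = 0"
  using rf_eq_0I[of T f] by (auto simp: rf_value_def)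

definition ratmap_at :: "ratfun ^ 'n \<Rightarrow> complex \<Rightarrow> complex ^ 'n" where
  "ratmap_at \<phi> t = (\<chi> i. rf_eval (\<phi> $ i) t)"

definition ratmap_domain :: "ratfun ^ 'n \<Rightarrow> complex set" where
  "ratmap_domain \<phi> = {t. \<forall>i. rf_regular_at (\<phi> $ i) t}"

lemma ratmap_image_eq: "ratmap_image \<phi> = ratmap_at \<phi> ` ratmap_domain \<phi>"
  by (auto simp: ratmap_image_def ratmap_at_def ratmap_domain_def)

lemma rf_value_ratmap: "t \<in> ratmap_domain \<phi> \<Longrightarrow> rf_value (\<phi> $ i) t (ratmap_at \<phi> t $ i)"
  by (simp add: rf_value_def ratmap_at_def ratmap_domain_def)

lemma rf_value_matrix:
  assumes "t \<in> ratmap_domain \<phi>"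
  shows "rf_value ((map_matrix rf_const A *v \<phi>) $ i) t ((A *v ratmap_at \<phi> t) $ i)"
  unfolding matrix_vector_mult_def map_matrix_def
  by (auto intro!: rf_value_sum rf_value_intros rf_value_ratmap assms)

lemma cofinite_ratmap_domain: "finite (- ratmap_domain (\<phi> :: ratfun ^ 'n::finite))"
proof -
  have "- ratmap_domain \<phi> = (\<Union>i. {t. \<not> rf_regular_at (\<phi> $ i) t})" by (auto simp: ratmap_domain_def)
  then show ?thesis using finite_not_regular by simp
qed

lemma infinite_ratmap_domain: "infinite (ratmap_domain (\<phi> :: ratfun ^ 'n::finite))"
  using cofinite_ratmap_domain[of \<phi>] infinite_UNIV_char_0[where 'a=complex] Compl_partition2 finite_Un
  by metis

text \<open>A linear relation between the components is a linear form vanishing on the image, hence on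
  its closure and on the span of the closure.\<close>

lemma rf_independent_of_spanning:
  fixes \<phi> :: "ratfun ^ 'n::finite"
  assumes span: "vec.span (zariski_closure (ratmap_image \<phi>)) = UNIV"
    and rel: "(\<Sum>i\<in>UNIV. rf_const (c i) * \<phi> $ i) = 0"
  shows "c i = 0"
proof -
  define L where "L x = (\<Sum>i\<in>UNIV. c i * x $ i)" for x :: "complex ^ 'n"
  have pf: "polyfun vec_coords L"
    unfolding L_def by (intro polyfun_sum polyfun.intros(1,4) polyfun_vec_nth)
  have "L x = 0" if "x \<in> ratmap_image \<phi>" for x
  proof -
    obtain t where t: "x = ratmap_at \<phi> t" "t \<in> ratmap_domain \<phi>" using \<open>x \<in> ratmap_image \<phi>\<close>
      by (auto simp: ratmap_image_eq)
    have "rf_value (\<Sum>i\<in>UNIV. rf_const (c i) * \<phi> $ i) t (L x)"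
      unfolding L_def t(1) by (intro rf_value_sum rf_value_intros rf_value_ratmap t)
    then show ?thesis using rf_value_unique rf_value_intros(1)[of 0 t] unfolding rel by fastforce
  qed
  then have "zariski_closure (ratmap_image \<phi>) \<subseteq> {x. L x = 0}"
    using zariski_closure_vanish[OF pf] by blast
  moreover have "vec.subspace {x. L x = 0}"
    by (auto simp: vec.subspace_def L_def distrib_left sum.distrib mult.left_commute simp flip: sum_distrib_left)
  ultimately have "vec.span (zariski_closure (ratmap_image \<phi>)) \<subseteq> {x. L x = 0}"
    by (rule vec.span_minimal)
  then have "L (axis i 1) = 0" using span by blast
  then show ?thesis by (simp add: L_def axis_def if_distrib[of "\<lambda>x. _ * x"] cong: if_cong)
qed

section \<open>Tangency in the function field\<close>

text \<open>The algebraic relation \<open>P(u, v) = 0\<close> between \<open>u = \<phi>\<^sub>j\<close> and \<open>v = \<phi>\<^sub>i\<close> is a polynomial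
  vanishing on the curve. Both \<open>(u', v')\<close> and the corresponding components of \<open>A \<phi>\<close> are in the
  kernel of its differential at \<open>(u, v)\<close>, which is one-dimensional because the derivative in
  the direction of \<open>v\<close> does not vanish.\<close>

lemma rf_tangent_pair:
  fixes \<phi> :: "ratfun ^ 'n::finite"
  assumes A: "A \<in> lie_algebra (linear_symmetries (zariski_closure (ratmap_image \<phi>)))"
    and nc: "\<phi> $ j \<notin> range rf_const"
  shows "(map_matrix rf_const A *v \<phi>) $ i * rf_deriv (\<phi> $ j) =
    (map_matrix rf_const A *v \<phi>) $ j * rf_deriv (\<phi> $ i)"
proof -
  let ?X = "zariski_closure (ratmap_image \<phi>)"
  define u v where "u = \<phi> $ j" and "v = \<phi> $ i"
  define a b where "a = (map_matrix rf_const A *v \<phi>) $ j" and "b = (map_matrix rf_const A *v \<phi>) $ i"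
  obtain N p where rel: "(\<Sum>l\<le>N. rf_poly (p l) u * v ^ l) = 0"
    and sep: "(\<Sum>l\<le>N. of_nat l * rf_poly (p l) u * v ^ (l - 1)) \<noteq> 0"
    using rf_separable_relation[of u v] nc unfolding u_def by blast
  define P where "P x = (\<Sum>l\<le>N. poly (p l) (x $ j) * (x $ i) ^ l)" for x :: "complex ^ 'n"
  have pf: "polyfun vec_coords P"
    unfolding P_def by (intro polyfun_sum polyfun.mult polyfun_poly polyfun_power polyfun_vec_nth)
  have "P x = 0" if "x \<in> ratmap_image \<phi>" for x
  proof -
    obtain t where t: "x = ratmap_at \<phi> t" "t \<in> ratmap_domain \<phi>" using \<open>x \<in> ratmap_image \<phi>\<close>
      by (auto simp: ratmap_image_eq)
    have "rf_value (\<Sum>l\<le>N. rf_poly (p l) u * v ^ l) t (P x)"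
      unfolding P_def t(1) u_def v_def by (intro rf_value_sum rf_value_intros rf_value_ratmap t)
    then show ?thesis using rf_value_unique rf_value_intros(1)[of 0 t] unfolding rel by fastforce
  qed
  then have van: "P x = 0" if "x \<in> ?X" for x using zariski_closure_vanish[OF pf] that by blast
  \<comment> \<open>The partial derivatives of \<open>P\<close> at the generic point \<open>(u, v)\<close>.\<close>
  define S1 where "S1 = (\<Sum>l\<le>N. rf_poly (pderiv (p l)) u * v ^ l)"
  define S2 where "S2 = (\<Sum>l\<le>N. of_nat l * rf_poly (p l) u * v ^ (l - 1))"
  have "S1 * a + S2 * b = 0"
  proof (rule rf_value_zero[OF infinite_ratmap_domain[of \<phi>]])
    fix t assume t: "t \<in> ratmap_domain \<phi>"
    define x where "x = ratmap_at \<phi> t"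
    define y where "y = A *v x"
    have "x \<in> ?X" using zariski_closure_superset[of "ratmap_image \<phi>"] t
      by (auto simp: ratmap_image_eq x_def)
    from lie_algebra_tangent[OF A pf van this]
    have "((\<lambda>s. P (x + s *s y)) has_field_derivative 0) (at 0)" by (simp add: y_def)
    moreover have "((\<lambda>s. P (x + s *s y)) has_field_derivative
        (\<Sum>l\<le>N. poly (pderiv (p l)) (x $ j) * (x $ i) ^ l) * y $ j +
        (\<Sum>l\<le>N. of_nat l * poly (p l) (x $ j) * (x $ i) ^ (l - 1)) * y $ i) (at 0)"
      unfolding P_def sum_distrib_right sum.distrib[symmetric]
      by (auto intro!: derivative_eq_intros poly_DERIV[THEN DERIV_chain2] simp: algebra_simps)
    ultimately have E0: "(\<Sum>l\<le>N. poly (pderiv (p l)) (x $ j) * (x $ i) ^ l) * y $ j +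
        (\<Sum>l\<le>N. of_nat l * poly (p l) (x $ j) * (x $ i) ^ (l - 1)) * y $ i = 0"
      using DERIV_unique by blast
    have "rf_value (S1 * a + S2 * b) t ((\<Sum>l\<le>N. poly (pderiv (p l)) (x $ j) * (x $ i) ^ l) * y $ j +
        (\<Sum>l\<le>N. of_nat l * poly (p l) (x $ j) * (x $ i) ^ (l - 1)) * y $ i)"
      unfolding S1_def S2_def a_def b_def u_def v_def x_def y_def
      by (intro rf_value_sum rf_value_intros rf_value_ratmap rf_value_matrix t)
    then show "rf_value (S1 * a + S2 * b) t 0" by (simp only: E0)
  qed
  moreover have "S1 * rf_deriv u + S2 * rf_deriv v = 0"
  proof -
    have "0 = rf_deriv (\<Sum>l\<le>N. rf_poly (p l) u * v ^ l)" unfolding rel by simp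
    also have "\<dots> = S1 * rf_deriv u + S2 * rf_deriv v"
      unfolding S1_def S2_def rf_deriv_sum sum_distrib_right sum.distrib[symmetric]
      by (intro sum.cong[OF refl]) (simp add: rf_deriv_poly rf_deriv_power algebra_simps)
    finally show ?thesis by simp
  qed
  moreover have "S2 * (b * rf_deriv u - a * rf_deriv v) =
      (S1 * a + S2 * b) * rf_deriv u - a * (S1 * rf_deriv u + S2 * rf_deriv v)"
    by (simp add: algebra_simps)
  ultimately have "S2 * (b * rf_deriv u - a * rf_deriv v) = 0" by simp
  then show ?thesis using sep by (simp add: S2_def a_def b_def u_def v_def)
qed

lemma rf_independent_nonconst:
  fixes \<phi> :: "ratfun ^ 'n::finite"
  assumes card: "CARD('n) \<ge> 2"
    and indep: "\<And>c i. (\<Sum>i\<in>UNIV. rf_const (c i) * \<phi> $ i) = 0 \<Longrightarrow> c i = 0"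
  obtains j where "\<phi> $ j \<notin> range rf_const"
proof -
  have "\<exists>j. \<phi> $ j \<notin> range rf_const"
  proof (rule ccontr)
    assume "\<not> ?thesis"
    then have "\<forall>j. \<exists>k. \<phi> $ j = rf_const k" by blast
    then obtain k where k: "\<And>j. \<phi> $ j = rf_const (k j)" by metis
    have "\<not> (UNIV :: 'n set) \<subseteq> {i}" for i using card card_mono[of "{i}" "UNIV :: 'n set"] by auto
    then obtain a b :: 'n where ab: "a \<noteq> b" by (metis UNIV_I singletonI subsetI)
    define c where "c i = (if i = a then k b else if i = b then - k a else 0)" for i
    have "(\<Sum>i\<in>UNIV. rf_const (c i) * \<phi> $ i) = (\<Sum>i\<in>{a, b}. rf_const (c i) * \<phi> $ i)"
      by (intro sum.mono_neutral_right) (auto simp: c_def)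
    also have "\<dots> = 0" using ab by (simp add: c_def k)
    finally have "c b = 0" by (rule indep)
    then have "k a = 0" using ab by (simp add: c_def)
    then have "(\<Sum>i\<in>UNIV. rf_const (if i = a then 1 else 0) * \<phi> $ i) = 0"
      by (intro sum.neutral) (auto simp: k)
    from indep[OF this, of a] show False by simp
  qed
  then show thesis using that by blast
qed

text \<open>The tangent direction of the curve at its generic point is \<open>\<phi>'\<close>.\<close>

lemma rf_tangent:
  fixes \<phi> :: "ratfun ^ 'n::finite"
  assumes A: "A \<in> lie_algebra (linear_symmetries (zariski_closure (ratmap_image \<phi>)))"
    and nc: "\<phi> $ j \<notin> range rf_const"
  obtains w where "\<And>i. (map_matrix rf_const A *v \<phi>) $ i = w * rf_deriv (\<phi> $ i)"
proof
  fix i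
  have "rf_deriv (\<phi> $ j) \<noteq> 0" using nc by (simp add: rf_deriv_eq_0_iff)
  then show "(map_matrix rf_const A *v \<phi>) $ i =
      (map_matrix rf_const A *v \<phi>) $ j / rf_deriv (\<phi> $ j) * rf_deriv (\<phi> $ i)"
    using rf_tangent_pair[OF A nc, of i] by (simp add: field_simps)
qed

section \<open>Power coordinates from an infinitesimal symmetry\<close>

lemma strict_mono_index: "strict_mono (index :: 'n::{finite,linorder} \<Rightarrow> nat)"
  unfolding strict_mono_def index_def by (auto intro!: psubset_card_mono)

lemma index_less: "index (i :: 'n::{finite,linorder}) < CARD('n)"
  unfolding index_def by (rule psubset_card_mono) auto

lemma strict_mono_enumeration:
  assumes "finite E" "card E = CARD('n)"
  obtains e :: "'n::{finite,linorder} \<Rightarrow> int" where "strict_mono e" "range e = E"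
proof
  define e where "e i = sorted_list_of_set E ! index i" for i :: 'n
  show mono: "strict_mono e"
    unfolding strict_mono_def e_def
    using strict_mono_index index_less assms
    by (auto intro!: sorted_wrt_nth_less[OF strict_sorted_list_of_set] simp: strict_mono_def)
  have "range e \<subseteq> E"
    using index_less assms by (auto simp: e_def intro!: nth_mem[THEN rev_subsetD])
  moreover have "card (range e) = card E"
    using card_image[OF strict_mono_imp_inj_on[OF mono]] assms by simp
  ultimately show "range e = E" using assms(1) by (simp add: card_subset_eq)
qed

lemma rf_powers_independent_family:
  fixes e :: "'n::finite \<Rightarrow> int"
  assumes r: "r \<notin> range rf_const" and e: "inj e"
    and rel: "(\<Sum>i\<in>UNIV. rf_const (c i) * r powi e i) = 0"
  shows "c i = 0"
proof -
  have "(\<Sum>m\<in>range e. rf_const (c (inv e m)) * r powi m) = 0"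
    using rel by (simp add: sum.reindex[OF e] inv_f_f[OF e])
  from rf_powers_independent[OF r _ this, of "e i"] show ?thesis by (simp add: inv_f_f[OF e])
qed

lemma rf_span_range:
  fixes \<phi> :: "ratfun ^ 'n::finite"
  assumes "v \<in> rfv.span (range (($) \<phi>))"
  obtains c where "v = (\<Sum>k\<in>UNIV. rf_const (c k) * \<phi> $ k)"
proof -
  let ?S = "{v. \<exists>c. v = (\<Sum>k\<in>UNIV. rf_const (c k) * \<phi> $ k)}"
  have "rfv.subspace ?S"
  proof (rule rfv.subspaceI)
    show "0 \<in> ?S" by (auto intro!: exI[of _ "\<lambda>_. 0"])
  next
    fix x y assume "x \<in> ?S" "y \<in> ?S"
    then obtain c d where "x = (\<Sum>k\<in>UNIV. rf_const (c k) * \<phi> $ k)"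
      "y = (\<Sum>k\<in>UNIV. rf_const (d k) * \<phi> $ k)" by auto
    then have "x + y = (\<Sum>k\<in>UNIV. rf_const (c k + d k) * \<phi> $ k)"
      by (simp add: sum.distrib distrib_right)
    then show "x + y \<in> ?S" by (auto intro!: exI[of _ "\<lambda>k. c k + d k"])
  next
    fix a x assume "x \<in> ?S"
    then obtain c where "x = (\<Sum>k\<in>UNIV. rf_const (c k) * \<phi> $ k)" by auto
    then have "rf_scale a x = (\<Sum>k\<in>UNIV. rf_const (a * c k) * \<phi> $ k)"
      by (simp add: rf_scale_def sum_distrib_left mult.assoc)
    then show "rf_scale a x \<in> ?S" by (auto intro!: exI[of _ "\<lambda>k. a * c k"])
  qed
  moreover have "range (($) \<phi>) \<subseteq> ?S"
  proof clarify
    fix i show "\<exists>c. \<phi> $ i = (\<Sum>k\<in>UNIV. rf_const (c k) * \<phi> $ k)"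
      by (intro exI[of _ "\<lambda>k. if k = i then 1 else 0"])
        (simp add: if_distrib[of rf_const] if_distrib[of "\<lambda>x. x * _"] cong: if_cong)
  qed
  ultimately have "rfv.span (range (($) \<phi>)) \<subseteq> ?S" by (rule rfv.span_minimal[rotated])
  then show thesis using assms that by blast
qed

text \<open>The coordinates of the chosen powers of \<open>r\<close> with respect to the components of \<open>\<phi>\<close> form the
  matrix of the coordinate change. It is invertible because distinct powers of \<open>r\<close> are
  linearly independent.\<close>

lemma power_form_of_exponents:
  fixes \<phi> :: "ratfun ^ 'n::{finite,linorder}"
  assumes r: "r \<notin> range rf_const" and E: "finite E" "card E = CARD('n)" "Gcd E = 1"
    and V: "\<And>e. e \<in> E \<Longrightarrow> r powi e \<in> rfv.span (range (($) \<phi>))"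
  shows "\<exists>g e. power_form \<phi> g r e"
proof -
  obtain e :: "'n \<Rightarrow> int" where e: "strict_mono e" "range e = E"
    using strict_mono_enumeration[OF E(1,2)] .
  have "\<exists>c. r powi e i = (\<Sum>k\<in>UNIV. rf_const (c k) * \<phi> $ k)" for i
    using rf_span_range[OF V[of "e i"]] e(2) by blast
  then obtain c where c: "\<And>i. r powi e i = (\<Sum>k\<in>UNIV. rf_const (c i k) * \<phi> $ k)" by metis
  define g where "g = (\<chi> i k. c i k)"
  have eq: "map_matrix rf_const g *v \<phi> = (\<chi> i. r powi e i)"
    by (simp add: vec_eq_iff matrix_vector_mult_def map_matrix_def g_def c)
  have "\<forall>d. (\<Sum>i\<in>UNIV. d i *s row i g) = 0 \<longrightarrow> (\<forall>i. d i = 0)"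
  proof (intro allI impI)
    fix d i assume "(\<Sum>i\<in>UNIV. d i *s row i g) = 0"
    then have d: "(\<Sum>i\<in>UNIV. d i * c i k) = 0" for k
      by (simp add: vec_eq_iff row_def g_def)
    have "(\<Sum>i\<in>UNIV. rf_const (d i) * r powi e i) =
        (\<Sum>i\<in>UNIV. \<Sum>k\<in>UNIV. rf_const (d i * c i k) * \<phi> $ k)"
      by (simp add: c sum_distrib_left mult.assoc)
    also have "\<dots> = (\<Sum>k\<in>UNIV. rf_const (\<Sum>i\<in>UNIV. d i * c i k) * \<phi> $ k)"
      by (subst sum.swap) (simp add: rf_const_sum sum_distrib_right)
    also have "\<dots> = 0" by (simp add: d)
    finally show "d i = 0"
      by (rule rf_powers_independent_family[OF r strict_mono_imp_inj_on[OF e(1)]])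
  qed
  then have "\<exists>B. g ** B = mat 1" by (simp only: matrix_right_invertible_independent_rows)
  then have "invertible g" by (simp only: invertible_right_inverse)
  then show ?thesis using r e E eq by (auto simp: power_form_def)
qed

text \<open>Tangency makes the span of the components stable under \<open>w d/dt\<close>, and the two kinds of stable
  spaces both contain enough powers of a single rational function.\<close>

theorem power_form_of_nonzero_symmetry:
  fixes \<phi> :: "ratfun ^ 'n::{finite,linorder}"
  assumes card: "CARD('n) \<ge> 2"
    and span: "vec.span (zariski_closure (ratmap_image \<phi>)) = UNIV"
    and A: "A \<in> lie_algebra (linear_symmetries (zariski_closure (ratmap_image \<phi>)))" "A \<noteq> 0"
  shows "\<exists>g r e. power_form \<phi> g r e"
proof -
  note indep = rf_independent_of_spanning[OF span]
  obtain j where j: "\<phi> $ j \<notin> range rf_const"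
    using rf_independent_nonconst[of \<phi>, OF card] indep by metis
  obtain w where w: "\<And>i. (map_matrix rf_const A *v \<phi>) $ i = w * rf_deriv (\<phi> $ i)"
    using rf_tangent[OF A(1) j] by blast
  have Aphi: "(\<Sum>k\<in>UNIV. rf_const (A $ i $ k) * \<phi> $ k) = w * rf_deriv (\<phi> $ i)" for i
    using w[of i] by (simp add: matrix_vector_mult_def map_matrix_def)
  have w0: "w \<noteq> 0"
  proof
    assume "w = 0"
    then have "A $ i $ k = 0" for i k using indep[of "\<lambda>k. A $ i $ k"] Aphi by simp
    then show False using A(2) by (simp add: vec_eq_iff)
  qed
  define B where "B = range (($) \<phi>)"
  have inj: "inj (($) \<phi>)"
  proof (rule injI, rule ccontr)
    fix a b assume ab: "\<phi> $ a = \<phi> $ b" "a \<noteq> b"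
    define c where "c i = (if i = a then 1 else if i = b then - 1 else 0 :: complex)" for i
    have "(\<Sum>i\<in>UNIV. rf_const (c i) * \<phi> $ i) = (\<Sum>i\<in>{a, b}. rf_const (c i) * \<phi> $ i)"
      by (intro sum.mono_neutral_right) (auto simp: c_def)
    also have "\<dots> = 0" using ab by (simp add: c_def)
    finally have "c a = 0" by (rule indep)
    then show False by (simp add: c_def)
  qed
  have B: "finite B" "card B = CARD('n)" by (simp_all add: B_def card_image[OF inj])
  have indB: "rfv.independent B"
  proof
    assume "rfv.dependent B"
    then obtain c where c: "\<exists>v\<in>B. c v \<noteq> 0" "(\<Sum>v\<in>B. rf_scale (c v) v) = 0"
      by (auto simp: rfv.dependent_finite[OF B(1)])
    then have "(\<Sum>i\<in>UNIV. rf_const (c (\<phi> $ i)) * \<phi> $ i) = 0"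
      by (simp add: B_def sum.reindex[OF inj] rf_scale_def)
    then have "c (\<phi> $ i) = 0" for i by (rule indep)
    then show False using c(1) by (auto simp: B_def)
  qed
  define V where "V = rfv.span B"
  have V: "rfv.subspace V" by (simp add: V_def)
  have stable: "w * rf_deriv v \<in> V" if "v \<in> V" for v
  proof -
    have "rfv.subspace {v. w * rf_deriv v \<in> V}"
    proof (rule rfv.subspaceI)
      fix c x assume "x \<in> {v. w * rf_deriv v \<in> V}"
      then have "rf_scale c (w * rf_deriv x) \<in> V" using rfv.subspace_scale[OF V] by blast
      then show "rf_scale c x \<in> {v. w * rf_deriv v \<in> V}"
        by (simp add: rf_scale_def mult.left_commute)
    qed (auto simp: distrib_left rfv.subspace_0[OF V] intro: rfv.subspace_add[OF V])
    moreover have "B \<subseteq> {v. w * rf_deriv v \<in> V}"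
      unfolding B_def
    proof clarify
      fix i
      have "(\<Sum>k\<in>UNIV. rf_scale (A $ i $ k) (\<phi> $ k)) \<in> V"
        unfolding V_def B_def by (intro rfv.span_sum rfv.span_scale rfv.span_base) auto
      then show "w * rf_deriv (\<phi> $ i) \<in> V" using Aphi by (simp add: rf_scale_def)
    qed
    ultimately have "rfv.span B \<subseteq> {v. w * rf_deriv v \<in> V}" by (rule rfv.span_minimal[rotated])
    then show ?thesis using that V_def by blast
  qed
  have "card B \<ge> 2" using card B by simp
  have "\<exists>r E. r \<notin> range rf_const \<and> finite E \<and> card E = card B \<and> Gcd E = 1 \<and> (\<forall>e\<in>E. r powi e \<in> V)"
  proof (cases "\<exists>z. w * rf_deriv z = 1")
    case True
    then obtain z where "w * rf_deriv z = 1" ..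
    from rf_translation_exponents[OF V stable B(1) V_def indB \<open>card B \<ge> 2\<close> this] show ?thesis .
  next
    case False
    then show ?thesis
      using rf_torus_exponents[OF V stable B(1) V_def indB \<open>card B \<ge> 2\<close> w0] by blast
  qed
  then obtain r E where r: "r \<notin> range rf_const" and E: "finite E" "card E = card B" "Gcd E = 1"
    and pow: "\<And>e. e \<in> E \<Longrightarrow> r powi e \<in> V" by blast
  have "card E = CARD('n)" using E(2) B(2) by simp
  have "\<exists>g e. power_form \<phi> g r e"
    by (rule power_form_of_exponents[OF r E(1) \<open>card E = CARD('n)\<close> E(3)])
      (use pow in \<open>simp add: V_def B_def\<close>)
  then show ?thesis by blast
qed

section \<open>One-parameter groups acting on curves of powers\<close>

definition power_vec :: "('n \<Rightarrow> int) \<Rightarrow> complex \<Rightarrow> complex ^ 'n" where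
  "power_vec e y = (\<chi> i. y powi e i)"

text \<open>The points \<open>(y\<^bsup>e\<^sub>i\<^esup>)\<close> with distinct exponents span the whole space, so matrix identities
  such as the group law of a one-parameter group can be checked on the curve.\<close>

lemma power_vec_separates:
  fixes e :: "'n::finite \<Rightarrow> int" and A B :: "complex ^ 'n ^ 'n"
  assumes e: "inj e" and eq: "\<And>y. y \<noteq> 0 \<Longrightarrow> A *v power_vec e y = B *v power_vec e y"
  shows "A = B"
proof -
  have "A $ i $ j - B $ i $ j = 0" for i j
  proof -
    define c where "c m = A $ i $ inv e m - B $ i $ inv e m" for m
    have "c (e j) = 0"
    proof (rule laurent_zero[of "range e" "- {0}" c])
      have "infinite (UNIV :: complex set)" by (rule infinite_UNIV_char_0)
      then show "infinite (- {0} :: complex set)" by (simp add: finite_compl)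
      fix y :: complex assume "y \<in> - {0}"
      then have "(A *v power_vec e y) $ i = (B *v power_vec e y) $ i" using eq by simp
      then have "(\<Sum>k\<in>UNIV. (A $ i $ k - B $ i $ k) * y powi e k) = 0"
        by (simp add: matrix_vector_mult_def power_vec_def left_diff_distrib sum_subtractf)
      then show "(\<Sum>m\<in>range e. c m * y powi m) = 0"
        by (simp add: sum.reindex[OF e] c_def inv_f_f[OF e])
    qed auto
    then show ?thesis by (simp add: c_def inv_f_f[OF e])
  qed
  then show ?thesis by (simp add: vec_eq_iff)
qed

lemma linear_symmetries_zariski_closureI:
  assumes hk: "h ** k = mat 1" "k ** h = mat 1"
    and h: "\<And>x. x \<in> S \<Longrightarrow> h *v x \<in> S" and k: "\<And>x. x \<in> S \<Longrightarrow> k *v x \<in> S"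
  shows "h \<in> linear_symmetries (zariski_closure S)"
proof -
  have stable: "m *v x \<in> zariski_closure S"
    if m: "\<And>x. x \<in> S \<Longrightarrow> m *v x \<in> S" and x: "x \<in> zariski_closure S" for m x
    unfolding zariski_closure_def
  proof (intro CollectI allI impI)
    fix p :: "complex ^ 'a \<Rightarrow> complex" assume p: "polyfun vec_coords p" "\<forall>y\<in>S. p y = 0"
    show "p (m *v x) = 0"
      by (rule zariski_closure_vanish[OF polyfun_matrix_left[OF p(1)] _ x]) (use p m in blast)
  qed
  have "x \<in> (\<lambda>x. h *v x) ` zariski_closure S" if "x \<in> zariski_closure S" for x
    using stable[OF k that] by (intro image_eqI[of _ _ "k *v x"]) (simp_all add: matrix_vector_mul_assoc hk)
  then have "(\<lambda>x. h *v x) ` zariski_closure S = zariski_closure S"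
    using stable[OF h] by blast
  moreover have "invertible h" using hk by (auto simp: invertible_def)
  ultimately show ?thesis by (simp add: linear_symmetries_def)
qed

text \<open>A reparametrization of the curve that a linear map \<open>M\<close> realizes is a symmetry of its
  closure. The matrix \<open>N\<close> realizes the inverse reparametrization \<open>f'\<close>, and \<open>G\<close> translates from
  power coordinates to the given ones.\<close>

lemma linear_symmetries_of_reparametrization:
  fixes e :: "'n::finite \<Rightarrow> int" and g G :: "complex ^ 'n ^ 'n"
  assumes gG: "g ** G = mat 1" "G ** g = mat 1" and e: "inj e"
    and M: "\<And>y. y \<in> Y \<Longrightarrow> M *v power_vec e y = power_vec e (f y)"
    and N: "\<And>y. y \<in> Y \<Longrightarrow> N *v power_vec e y = power_vec e (f' y)"
    and f: "\<And>y. y \<in> Y \<Longrightarrow> f y \<in> Y \<and> f' y \<in> Y \<and> f (f' y) = y \<and> f' (f y) = y"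
    and Y: "- {0} \<subseteq> Y"
  shows "G ** M ** g \<in> linear_symmetries (zariski_closure ((\<lambda>y. G *v power_vec e y) ` Y))"
proof -
  have MN: "M ** N = mat 1" "N ** M = mat 1"
    using f M N Y by (auto intro!: power_vec_separates[OF e] simp: matrix_vector_mul_assoc[symmetric] subset_iff)
  have conj: "(G ** P ** g) ** (G ** Q ** g) = G ** (P ** Q) ** g" for P Q
    by (metis gG(1) matrix_mul_assoc matrix_mul_lid)
  have act: "(G ** P ** g) *v (G *v x) = G *v (P *v x)" for P x
    by (metis gG(1) matrix_mul_assoc matrix_mul_rid matrix_vector_mul_assoc)
  show ?thesis
  proof (rule linear_symmetries_zariski_closureI[of _ "G ** N ** g"])
    show "G ** M ** g ** (G ** N ** g) = mat 1" "G ** N ** g ** (G ** M ** g) = mat 1"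
      unfolding conj MN by (simp_all add: gG)
  qed (use M N f act in auto)
qed

text \<open>By the chain rule the derivative of a polynomial along a curve depends only on the velocity
  of the curve, so the curve may be replaced by its tangent line.\<close>

lemma polyfun_curve_derivative:
  fixes \<gamma> :: "complex \<Rightarrow> complex ^ 'n ^ 'n" and A :: "complex ^ 'n ^ 'n"
  assumes p: "polyfun mat_coords p" and "\<gamma> z = mat 1"
    and d: "\<And>i j. ((\<lambda>s. \<gamma> s $ i $ j) has_field_derivative A $ i $ j) (at z)"
  shows "\<exists>d. ((\<lambda>s. p (\<gamma> s)) has_field_derivative d) (at z) \<and>
    ((\<lambda>s. p (mat 1 + mat_scale s A)) has_field_derivative d) (at 0)"
  using p
proof induction
  case (const c)
  then show ?case by (intro exI[of _ 0]) auto
next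
  case (coord p)
  then obtain i j where p: "p = (\<lambda>A. A $ i $ j)" by (auto simp: mat_coords_def)
  have "((\<lambda>s. (mat 1 + mat_scale s A) $ i $ j) has_field_derivative A $ i $ j) (at 0)"
    unfolding mat_scale_def by (auto intro!: derivative_eq_intros)
  then show ?case using d[of i j] p by blast
next
  case (add p q)
  then obtain a b where
    a: "((\<lambda>s. p (\<gamma> s)) has_field_derivative a) (at z)"
       "((\<lambda>s. p (mat 1 + mat_scale s A)) has_field_derivative a) (at 0)" and
    b: "((\<lambda>s. q (\<gamma> s)) has_field_derivative b) (at z)"
       "((\<lambda>s. q (mat 1 + mat_scale s A)) has_field_derivative b) (at 0)" by blast
  show ?case using DERIV_add[OF a(1) b(1)] DERIV_add[OF a(2) b(2)] by blast
next
  case (mult p q)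
  then obtain a b where
    a: "((\<lambda>s. p (\<gamma> s)) has_field_derivative a) (at z)"
       "((\<lambda>s. p (mat 1 + mat_scale s A)) has_field_derivative a) (at 0)" and
    b: "((\<lambda>s. q (\<gamma> s)) has_field_derivative b) (at z)"
       "((\<lambda>s. q (mat 1 + mat_scale s A)) has_field_derivative b) (at 0)" by blast
  have one: "mat 1 + mat_scale 0 A = mat 1" by (simp add: mat_scale_def vec_eq_iff)
  show ?case
    using DERIV_mult[OF a(1) b(1)] DERIV_mult[OF a(2) b(2)] assms(2) one by auto
qed

lemma curve_in_lie_algebra:
  fixes \<gamma> :: "complex \<Rightarrow> complex ^ 'n ^ 'n" and A :: "complex ^ 'n ^ 'n"
  assumes "\<gamma> z = mat 1"
    and d: "\<And>i j. ((\<lambda>s. \<gamma> s $ i $ j) has_field_derivative A $ i $ j) (at z)"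
    and U: "open U" "z \<in> U" "\<And>s. s \<in> U \<Longrightarrow> \<gamma> s \<in> H"
  shows "A \<in> lie_algebra H"
  unfolding lie_algebra_def
proof (intro CollectI allI impI)
  fix p :: "complex ^ 'n ^ 'n \<Rightarrow> complex" assume p: "polyfun mat_coords p" "\<forall>g\<in>H. p g = 0"
  obtain c where c: "((\<lambda>s. p (\<gamma> s)) has_field_derivative c) (at z)"
    "((\<lambda>s. p (mat 1 + mat_scale s A)) has_field_derivative c) (at 0)"
    using polyfun_curve_derivative[where \<gamma> = \<gamma> and A = A, OF p(1) assms(1) d] by blast
  have "((\<lambda>s. 0) has_field_derivative c) (at z)"
    using U p(2) by (intro has_field_derivative_transform_within_open[OF c(1), of U]) auto
  then have "c = 0" using DERIV_const DERIV_unique by blast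
  then show "((\<lambda>s. p (mat 1 + mat_scale s A)) has_field_derivative 0) (at 0)" using c(2) by simp
qed

lemma conjugate_curve_in_lie_algebra:
  fixes g G N :: "complex ^ 'n::finite ^ 'n" and M :: "complex \<Rightarrow> complex ^ 'n ^ 'n"
  assumes "G ** g = mat 1" and M: "M z = mat 1"
    and d: "\<And>i j. ((\<lambda>s. M s $ i $ j) has_field_derivative N $ i $ j) (at z)"
    and U: "open U" "z \<in> U" "\<And>s. s \<in> U \<Longrightarrow> G ** M s ** g \<in> H"
  shows "G ** N ** g \<in> lie_algebra H"
proof (rule curve_in_lie_algebra[OF _ _ U])
  show "G ** M z ** g = mat 1" by (simp add: M assms(1))
  fix i j
  show "((\<lambda>s. (G ** M s ** g) $ i $ j) has_field_derivative (G ** N ** g) $ i $ j) (at z)"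
    unfolding matrix_matrix_mult_def
    by (auto intro!: derivative_eq_intros d simp: sum_distrib_right mult_ac)
qed

definition diag_mat :: "('n \<Rightarrow> complex) \<Rightarrow> complex ^ 'n ^ 'n" where
  "diag_mat d = (\<chi> i j. if i = j then d i else 0)"

lemma diag_mat_vec: "diag_mat d *v x = (\<chi> i. d i * x $ i)"
  by (simp add: diag_mat_def matrix_vector_mult_def vec_eq_iff if_distrib[of "\<lambda>x. x * _"] cong: if_cong)

text \<open>The one-parameter group \<open>y \<mapsto> s y\<close>, differentiated at \<open>s = 1\<close>.\<close>

lemma torus_in_lie_algebra:
  fixes e :: "'n::finite \<Rightarrow> int" and g G :: "complex ^ 'n ^ 'n"
  assumes gG: "g ** G = mat 1" "G ** g = mat 1" and e: "inj e"
  shows "G ** diag_mat (\<lambda>i. of_int (e i)) ** g \<in>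
    lie_algebra (linear_symmetries (zariski_closure ((\<lambda>y. G *v power_vec e y) ` (- {0}))))"
proof (rule conjugate_curve_in_lie_algebra[where M = "\<lambda>s. diag_mat (\<lambda>i. s powi e i)" and z = 1 and U = "- {0}"])
  show "diag_mat (\<lambda>i. 1 powi e i) = mat 1" by (simp add: diag_mat_def mat_def)
  show "((\<lambda>s. diag_mat (\<lambda>i. s powi e i) $ i $ j) has_field_derivative
      diag_mat (\<lambda>i. of_int (e i)) $ i $ j) (at 1)" for i j
    by (cases "i = j") (auto simp: diag_mat_def intro!: derivative_eq_intros)
  show "G ** diag_mat (\<lambda>i. s powi e i) ** g \<in>
      linear_symmetries (zariski_closure ((\<lambda>y. G *v power_vec e y) ` (- {0})))" if "s \<in> - {0}" for s
    by (rule linear_symmetries_of_reparametrization[OF gG e, where f = "\<lambda>y. s * y" and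
        N = "diag_mat (\<lambda>i. inverse s powi e i)" and f' = "\<lambda>y. inverse s * y"])
      (use that in \<open>auto simp: diag_mat_vec power_vec_def power_int_mult_distrib\<close>)
qed (use gG in auto)

text \<open>The one-parameter group \<open>y \<mapsto> y + s\<close>, differentiated at \<open>s = 0\<close>. It acts linearly on
  \<open>(1, y, \<dots>, y\<^bsup>n-1\<^esup>)\<close> by the binomial theorem, with the coordinates ordered by \<open>\<sigma>\<close>. The
  parameter \<open>y = 0\<close> has to be allowed because translations move other parameters to it.\<close>

lemma unipotent_in_lie_algebra:
  fixes \<sigma> :: "'n::finite \<Rightarrow> nat" and g G :: "complex ^ 'n ^ 'n"
  assumes gG: "g ** G = mat 1" "G ** g = mat 1" and \<sigma>: "bij_betw \<sigma> UNIV {..<CARD('n)}"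
  shows "G ** (\<chi> i k. if Suc (\<sigma> k) = \<sigma> i then of_nat (\<sigma> i) else 0) ** g \<in>
    lie_algebra (linear_symmetries (zariski_closure (range (\<lambda>y. G *v power_vec (\<lambda>i. int (\<sigma> i)) y))))"
proof -
  define M :: "complex \<Rightarrow> complex ^ 'n ^ 'n" where
    "M s = (\<chi> i k. of_nat (\<sigma> i choose \<sigma> k) * s ^ (\<sigma> i - \<sigma> k))" for s
  define e where "e = (\<lambda>i. int (\<sigma> i))"
  have inj: "inj e" using \<sigma> by (auto simp: e_def bij_betw_def inj_def)
  have M: "M s *v power_vec e y = power_vec e (y + s)" for s y
  proof -
    have "(\<Sum>k\<in>UNIV. of_nat (\<sigma> i choose \<sigma> k) * s ^ (\<sigma> i - \<sigma> k) * y ^ \<sigma> k) = (y + s) ^ \<sigma> i" for i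
    proof -
      have "\<sigma> i < CARD('n)" using \<sigma> by (auto simp: bij_betw_def)
      have "(\<Sum>k\<in>UNIV. of_nat (\<sigma> i choose \<sigma> k) * s ^ (\<sigma> i - \<sigma> k) * y ^ \<sigma> k) =
          (\<Sum>m<CARD('n). of_nat (\<sigma> i choose m) * s ^ (\<sigma> i - m) * y ^ m)"
        by (rule sum.reindex_bij_betw[OF \<sigma>])
      also have "\<dots> = (\<Sum>m\<le>\<sigma> i. of_nat (\<sigma> i choose m) * s ^ (\<sigma> i - m) * y ^ m)"
        using \<open>\<sigma> i < CARD('n)\<close> by (intro sum.mono_neutral_right) (auto simp: binomial_eq_0)
      also have "\<dots> = (y + s) ^ \<sigma> i" by (simp add: binomial_ring mult_ac)
      finally show ?thesis .
    qed
    then show ?thesis by (simp add: M_def power_vec_def e_def matrix_vector_mult_def vec_eq_iff)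
  qed
  show ?thesis
    unfolding e_def[symmetric]
  proof (rule conjugate_curve_in_lie_algebra[where M = M and z = 0 and U = UNIV])
    show "M 0 = mat 1" by (rule power_vec_separates[OF inj]) (simp add: M)
    show "((\<lambda>s. M s $ i $ k) has_field_derivative
        (\<chi> i k. if Suc (\<sigma> k) = \<sigma> i then of_nat (\<sigma> i) else 0) $ i $ k) (at 0)" for i k
    proof -
      have "((\<lambda>s. M s $ i $ k) has_field_derivative
          of_nat (\<sigma> i choose \<sigma> k) * (of_nat (\<sigma> i - \<sigma> k) * 0 ^ (\<sigma> i - \<sigma> k - Suc 0))) (at 0)"
        unfolding M_def by (auto intro!: derivative_eq_intros)
      also have "of_nat (\<sigma> i choose \<sigma> k) * (of_nat (\<sigma> i - \<sigma> k) * 0 ^ (\<sigma> i - \<sigma> k - Suc 0)) =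
          (if Suc (\<sigma> k) = \<sigma> i then of_nat (\<sigma> i) else 0 :: complex)"
      proof (cases "Suc (\<sigma> k) = \<sigma> i")
        case True
        then show ?thesis by (simp flip: True)
      qed (cases "\<sigma> i \<le> \<sigma> k", auto simp: power_0_left)
      finally show ?thesis by simp
    qed
    show "G ** M s ** g \<in> linear_symmetries (zariski_closure (range (\<lambda>y. G *v power_vec e y)))" for s
      by (rule linear_symmetries_of_reparametrization[OF gG inj, where f = "\<lambda>y. y + s" and
          N = "M (-s)" and f' = "\<lambda>y. y - s"]) (auto simp: M)
  qed (use gG in auto)
qed

section \<open>Zariski closure in power coordinates\<close>

text \<open>The factor \<open>y\<^bsup>N\<^esup>\<close> clears the negative exponents of a Laurent polynomial in \<open>y\<close>.\<close>

lemma polyfun_power_vec_laurent: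
  fixes G :: "complex ^ 'n::finite ^ 'n"
  assumes "polyfun vec_coords p"
  shows "\<exists>q N. \<forall>y. y \<noteq> 0 \<longrightarrow> p (G *v power_vec e y) * y ^ N = poly q y"
  using assms
proof induction
  case (const c)
  show ?case by (intro exI[of _ "[:c:]"] exI[of _ 0]) simp
next
  case (coord p)
  then obtain i where p: "p = (\<lambda>v. v $ i)" by (auto simp: vec_coords_def)
  obtain N where N: "\<And>k. 0 \<le> e k + int N"
  proof
    fix k
    have "- e k \<le> Max (range (\<lambda>k. - e k))" by (intro Max_ge) auto
    then show "0 \<le> e k + int (nat (Max (range (\<lambda>k. - e k))))" by linarith
  qed
  define q where "q = (\<Sum>k\<in>UNIV. monom (G $ i $ k) (nat (e k + int N)))"
  have "p (G *v power_vec e y) * y ^ N = poly q y" if "y \<noteq> 0" for y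
  proof -
    have "y powi e k * y ^ N = y ^ nat (e k + int N)" for k
      using that N[of k] power_int_add[of y "e k" "int N"] by (simp add: power_int_def)
    then show ?thesis
      by (simp add: p q_def poly_sum poly_monom matrix_vector_mult_def power_vec_def
          sum_distrib_right mult.assoc)
  qed
  then show ?case by blast
next
  case (add p1 p2)
  then obtain q1 N1 q2 N2 where
    "\<And>y. y \<noteq> 0 \<Longrightarrow> p1 (G *v power_vec e y) * y ^ N1 = poly q1 y"
    "\<And>y. y \<noteq> 0 \<Longrightarrow> p2 (G *v power_vec e y) * y ^ N2 = poly q2 y" by blast
  then have "(p1 (G *v power_vec e y) + p2 (G *v power_vec e y)) * y ^ (N1 + N2) =
      poly (q1 * monom 1 N2 + q2 * monom 1 N1) y" if "y \<noteq> 0" for y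
    using that by (simp add: poly_monom distrib_right power_add flip: mult.assoc)
  then show ?case by blast
next
  case (mult p1 p2)
  then obtain q1 N1 q2 N2 where
    *: "\<And>y. y \<noteq> 0 \<Longrightarrow> p1 (G *v power_vec e y) * y ^ N1 = poly q1 y"
    "\<And>y. y \<noteq> 0 \<Longrightarrow> p2 (G *v power_vec e y) * y ^ N2 = poly q2 y" by blast
  have "(p1 (G *v power_vec e y) * p2 (G *v power_vec e y)) * y ^ (N1 + N2) = poly (q1 * q2) y"
    if "y \<noteq> 0" for y
    using *[OF that, symmetric] by (simp add: power_add mult_ac)
  then show ?case by blast
qed

lemma polyfun_power_vec_poly:
  fixes G :: "complex ^ 'n::finite ^ 'n"
  assumes "polyfun vec_coords p"
  shows "\<exists>q. \<forall>y. p (G *v power_vec (\<lambda>i. int (\<sigma> i)) y) = poly q y"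
  using assms
proof induction
  case (const c)
  show ?case by (intro exI[of _ "[:c:]"]) simp
next
  case (coord p)
  then obtain i where p: "p = (\<lambda>v. v $ i)" by (auto simp: vec_coords_def)
  show ?case
    by (intro exI[of _ "\<Sum>k\<in>UNIV. monom (G $ i $ k) (\<sigma> k)"])
      (simp add: p poly_sum poly_monom matrix_vector_mult_def power_vec_def)
next
  case (add p1 p2)
  then show ?case by (metis poly_add)
next
  case (mult p1 p2)
  then show ?case by (metis poly_mult)
qed

lemma poly_vanishing_infinite: "infinite Y \<Longrightarrow> (\<And>y. y \<in> Y \<Longrightarrow> poly q y = 0) \<Longrightarrow> q = 0"
  for q :: "complex poly"
  using poly_roots_finite[of q] finite_subset[of Y "{y. poly q y = 0}"] by blast

lemma infinite_nonzero: "infinite (- {0} :: complex set)"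
  using infinite_UNIV_char_0[where 'a=complex] by (simp add: finite_compl)

text \<open>With exponents at least \<open>0\<close>, polynomial functions restrict to polynomials in \<open>y\<close>, which
  vanish at \<open>0\<close> if they vanish everywhere else.\<close>

lemma zariski_closure_add_zero:
  fixes G :: "complex ^ 'n::finite ^ 'n"
  shows "zariski_closure ((\<lambda>y. G *v power_vec (\<lambda>i. int (\<sigma> i)) y) ` (- {0})) =
    zariski_closure (range (\<lambda>y. G *v power_vec (\<lambda>i. int (\<sigma> i)) y))"
proof (rule zariski_closure_eqI)
  fix p :: "complex ^ 'n \<Rightarrow> complex" assume "polyfun vec_coords p"
  then obtain q where q: "\<And>y. p (G *v power_vec (\<lambda>i. int (\<sigma> i)) y) = poly q y"
    using polyfun_power_vec_poly by blast
  show "(\<forall>x\<in>(\<lambda>y. G *v power_vec (\<lambda>i. int (\<sigma> i)) y) ` (- {0}). p x = 0) \<longleftrightarrow>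
      (\<forall>x\<in>range (\<lambda>y. G *v power_vec (\<lambda>i. int (\<sigma> i)) y). p x = 0)"
    using poly_vanishing_infinite[OF infinite_nonzero, of q] by (auto simp: q)
qed

text \<open>A polynomial in the components of \<open>\<phi>\<close> is a rational function \<open>P\<close> that is regular wherever
  all components are. So if the polynomial vanishes at almost all points of the image, it
  vanishes at all of them.\<close>

lemma polyfun_ratmap:
  fixes \<phi> :: "ratfun ^ 'n::finite"
  assumes "polyfun vec_coords p"
  shows "\<exists>P. \<forall>t\<in>ratmap_domain \<phi>. rf_value P t (p (ratmap_at \<phi> t))"
  using assms
proof induction
  case (coord p)
  then obtain i where "p = (\<lambda>v. v $ i)" by (auto simp: vec_coords_def)
  then show ?case using rf_value_ratmap by blast
qed (blast intro: rf_value_intros)+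

text \<open>Away from finitely many parameters \<open>t\<close>, the point \<open>\<phi>(t)\<close> is the point of the curve of powers
  with parameter \<open>y = r(t)\<close>. Both curves are determined by infinitely many of their points: on
  one side a polynomial function is a rational function of \<open>t\<close>, on the other a Laurent
  polynomial in \<open>y\<close>, and \<open>r\<close> takes infinitely many values.\<close>

lemma zariski_closure_power_form:
  fixes \<phi> :: "ratfun ^ 'n::{finite,linorder}"
  assumes pf: "power_form \<phi> g r e" and G: "G ** g = mat 1"
  shows "zariski_closure (ratmap_image \<phi>) = zariski_closure ((\<lambda>y. G *v power_vec e y) ` (- {0}))"
proof (rule zariski_closure_eqI)
  fix p :: "complex ^ ('n::{finite,linorder}) \<Rightarrow> complex" assume p: "polyfun vec_coords p"
  have r: "r \<notin> range rf_const" and eq: "map_matrix rf_const g *v \<phi> = (\<chi> i. r powi e i)"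
    using pf by (auto simp: power_form_def)
  define T where "T = {t \<in> ratmap_domain \<phi>. rf_regular_at r t \<and> rf_eval r t \<noteq> 0}"
  have at: "ratmap_at \<phi> t = G *v power_vec e (rf_eval r t)" if t: "t \<in> T" for t
  proof -
    have "(g *v ratmap_at \<phi> t) $ i = power_vec e (rf_eval r t) $ i" for i
    proof (rule rf_value_unique)
      show "rf_value (r powi e i) t ((g *v ratmap_at \<phi> t) $ i)"
        using rf_value_matrix[of t \<phi> g i] t by (simp add: eq T_def)
      show "rf_value (r powi e i) t (power_vec e (rf_eval r t) $ i)"
        using t by (simp add: power_vec_def T_def) (intro rf_value_powi, simp_all add: rf_value_def)
    qed
    then have "g *v ratmap_at \<phi> t = power_vec e (rf_eval r t)" by (simp add: vec_eq_iff)
    then show ?thesis by (metis G matrix_vector_mul_assoc matrix_vector_mul_lid)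
  qed
  have "{rf_eval r t | t. t \<notin> - ratmap_domain \<phi> \<and> rf_regular_at r t \<and> rf_eval r t \<noteq> 0} = rf_eval r ` T"
    by (auto simp: T_def)
  then have inf: "infinite (rf_eval r ` T)"
    using rf_nonconst_values_infinite[OF r cofinite_ratmap_domain[of \<phi>]] by simp
  show "(\<forall>x\<in>ratmap_image \<phi>. p x = 0) \<longleftrightarrow> (\<forall>x\<in>(\<lambda>y. G *v power_vec e y) ` (- {0}). p x = 0)"
  proof
    assume van: "\<forall>x\<in>ratmap_image \<phi>. p x = 0"
    obtain q N where q: "\<And>y. y \<noteq> 0 \<Longrightarrow> p (G *v power_vec e y) * y ^ N = poly q y"
      using polyfun_power_vec_laurent[OF p] by blast
    have "q = 0"
    proof (rule poly_vanishing_infinite[OF inf])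
      fix y assume "y \<in> rf_eval r ` T"
      then obtain t where t: "y = rf_eval r t" "t \<in> T" by blast
      then have "p (G *v power_vec e y) = 0"
        using van at[OF t(2)] by (auto simp: ratmap_image_eq T_def)
      then show "poly q y = 0" using q[of y] t by (auto simp: T_def)
    qed
    then show "\<forall>x\<in>(\<lambda>y. G *v power_vec e y) ` (- {0}). p x = 0" using q by auto
  next
    assume van: "\<forall>x\<in>(\<lambda>y. G *v power_vec e y) ` (- {0}). p x = 0"
    obtain P where P: "\<And>t. t \<in> ratmap_domain \<phi> \<Longrightarrow> rf_value P t (p (ratmap_at \<phi> t))"
      using polyfun_ratmap[OF p] by blast
    have "P = 0"
    proof (rule rf_value_zero)
      show "infinite T" using inf by blast
      fix t assume t: "t \<in> T"
      then have "p (ratmap_at \<phi> t) = 0" using van at[OF t] by (auto simp: T_def)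
      then show "rf_value P t 0" using P[of t] t by (simp add: T_def)
    qed
    then show "\<forall>x\<in>ratmap_image \<phi>. p x = 0"
      using P rf_value_unique rf_value_intros(1)[of 0] by (fastforce simp: ratmap_image_eq)
  qed
qed

section \<open>Weights of infinitesimal symmetries\<close>

text \<open>In power coordinates \<open>\<phi>' = (e\<^sub>i r\<^bsup>e\<^sub>i\<^esup>) r'/r\<close>. Tangency therefore says that \<open>r\<^bsup>-e\<^sub>i\<^esup>\<close> times
  row \<open>i\<close> of \<open>B \<phi>\<close> is \<open>e\<^sub>i\<close> times an element of the function field that does not depend on
  \<open>i\<close>. Each row shows that it is a Laurent polynomial in \<open>r\<close>, with coefficients \<open>h\<close>, as long
  as \<open>e\<^sub>i \<noteq> 0\<close>.\<close>

lemma power_form_symmetry_weights: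
  fixes \<phi> :: "ratfun ^ 'n::{finite,linorder}"
  assumes pf: "power_form \<phi> g r e" and gG: "g ** G = mat 1" "G ** g = mat 1"
    and A: "A \<in> lie_algebra (linear_symmetries (zariski_closure (ratmap_image \<phi>)))"
    and nc: "\<phi> $ j0 \<notin> range rf_const"
  obtains h where "\<And>i k. (g ** A ** G) $ i $ k = of_int (e i) * h (e k - e i)"
    "\<And>d i. h d \<noteq> 0 \<Longrightarrow> e i \<noteq> 0 \<Longrightarrow> e i + d \<in> range e"
proof -
  have r: "r \<notin> range rf_const" and eq: "map_matrix rf_const g *v \<phi> = (\<chi> i. r powi e i)"
    and mono: "strict_mono e" and gcd: "Gcd (range e) = 1"
    using pf by (auto simp: power_form_def)
  have inj: "inj e" using mono by (rule strict_mono_imp_inj_on)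
  have r0: "r \<noteq> 0" using r by (metis rangeI rf_const_hom(1))
  define B where "B = g ** A ** G"
  obtain w where w: "\<And>i. (map_matrix rf_const A *v \<phi>) $ i = w * rf_deriv (\<phi> $ i)"
    using rf_tangent[OF A nc] by blast
  have wv: "map_matrix rf_const A *v \<phi> = (\<chi> i. w * rf_deriv (\<phi> $ i))"
    using w by (simp add: vec_eq_iff)
  have Bg: "B ** g = g ** A" by (metis B_def gG(2) matrix_mul_assoc matrix_mul_rid)
  have mm: "map_matrix rf_const (P ** Q) = map_matrix rf_const P ** map_matrix rf_const Q"
    for P Q :: "complex ^ ('n::{finite,linorder}) ^ ('n::{finite,linorder})"
    by (simp add: vec_eq_iff map_matrix_def matrix_matrix_mult_def rf_const_sum)
  have row: "(\<Sum>k\<in>UNIV. rf_const (B $ i $ k) * r powi e k) =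
      of_int (e i) * r powi e i * (w * rf_deriv r / r)" for i
  proof -
    have "(\<Sum>k\<in>UNIV. rf_const (B $ i $ k) * r powi e k) =
        (map_matrix rf_const B *v (map_matrix rf_const g *v \<phi>)) $ i"
      unfolding eq by (simp add: matrix_vector_mult_def map_matrix_def)
    also have "\<dots> = (map_matrix rf_const g *v (map_matrix rf_const A *v \<phi>)) $ i"
      by (simp only: matrix_vector_mul_assoc mm[symmetric] Bg)
    also have "\<dots> = w * rf_deriv ((map_matrix rf_const g *v \<phi>) $ i)"
      unfolding wv
      by (simp add: matrix_vector_mult_def rf_deriv_sum sum_distrib_left map_matrix_def mult.left_commute)
    also have "\<dots> = of_int (e i) * r powi e i * (w * rf_deriv r / r)"
      by (simp add: eq rf_deriv_power_int[OF r0])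
    finally show ?thesis .
  qed
  \<comment> \<open>The coefficient of \<open>r\<^bsup>m\<^esup>\<close> in row \<open>i\<close> of \<open>B \<phi>\<close>.\<close>
  define \<beta> where "\<beta> i m = (\<Sum>k\<in>UNIV. if e k = m then B $ i $ k else 0)" for i m
  have \<beta>_e: "\<beta> i (e k) = B $ i $ k" for i k
    by (simp add: \<beta>_def inj_eq[OF inj])
  have \<beta>_0: "m \<in> range e" if "\<beta> i m \<noteq> 0" for i m
    using that by (force simp: \<beta>_def intro: sum.neutral)
  have shift: "(\<Sum>m\<in>M. rf_const (\<beta> i (m - c)) * r powi m) =
      r powi c * (\<Sum>k\<in>UNIV. rf_const (B $ i $ k) * r powi e k)"
    if M: "finite M" "\<And>k. e k + c \<in> M" for M i c
  proof -
    have "(\<Sum>m\<in>M. rf_const (\<beta> i (m - c)) * r powi m) =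
        (\<Sum>m\<in>M. \<Sum>k\<in>UNIV. if m = e k + c then rf_const (B $ i $ k) * r powi m else 0)"
      unfolding \<beta>_def rf_const_sum sum_distrib_right
      by (intro sum.cong[OF refl]) auto
    also have "\<dots> = (\<Sum>k\<in>UNIV. rf_const (B $ i $ k) * r powi (e k + c))"
      using M by (subst sum.swap) (simp add: sum.delta)
    also have "\<dots> = r powi c * (\<Sum>k\<in>UNIV. rf_const (B $ i $ k) * r powi e k)"
      using r0 by (simp add: power_int_add sum_distrib_left mult_ac)
    finally show ?thesis .
  qed
  have sym: "of_int (e j) * \<beta> i (m - e j) = of_int (e i) * \<beta> j (m - e i)" for i j m
  proof -
    define M where "M = insert m ((\<lambda>k. e k + e j) ` UNIV \<union> (\<lambda>k. e k + e i) ` UNIV)"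
    have M: "finite M" "e k + e j \<in> M" "e k + e i \<in> M" "m \<in> M" for k by (auto simp: M_def)
    have "(\<Sum>m\<in>M. rf_const (of_int (e j) * \<beta> i (m - e j) - of_int (e i) * \<beta> j (m - e i)) * r powi m)
       = of_int (e j) * (\<Sum>m\<in>M. rf_const (\<beta> i (m - e j)) * r powi m) -
         of_int (e i) * (\<Sum>m\<in>M. rf_const (\<beta> j (m - e i)) * r powi m)"
      by (simp add: left_diff_distrib sum_subtractf sum_distrib_left mult.assoc)
    also have "\<dots> = 0" unfolding shift[OF M(1,2)] shift[OF M(1,3)] row by simp
    finally have "of_int (e j) * \<beta> i (m - e j) - of_int (e i) * \<beta> j (m - e i) = 0"
      by (rule rf_powers_independent[OF r M(1) _ M(4)])
    then show ?thesis by simp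
  qed
  have "\<exists>i. e i \<noteq> 0"
  proof (rule ccontr)
    assume "\<not> ?thesis"
    then have "range e = {0}" by auto
    then show False using gcd by simp
  qed
  then obtain i0 where i0: "e i0 \<noteq> 0" by blast
  define h where "h d = \<beta> i0 (e i0 + d) / of_int (e i0)" for d
  have \<beta>h: "\<beta> i (e i + d) = of_int (e i) * h d" for i d
    using sym[of i0 i "e i + e i0 + d"] i0 by (simp add: h_def field_simps add_ac)
  show thesis
  proof
    show "(g ** A ** G) $ i $ k = of_int (e i) * h (e k - e i)" for i k
      using \<beta>h[of i "e k - e i"] \<beta>_e[of i k] by (simp add: B_def)
    show "e i + d \<in> range e" if "h d \<noteq> 0" "e i \<noteq> 0" for d i
      using \<beta>_0[of i "e i + d"] \<beta>h that by simp
  qed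
qed

text \<open>The largest element cannot be shifted, so it is \<open>0\<close>. Every element reaches \<open>0\<close> by repeated
  shifts by \<open>d\<close>, so \<open>d\<close> divides all of them and is \<open>1\<close>; then \<open>E\<close> has no gaps.\<close>

lemma shift_invariant_exponents:
  fixes E :: "int set"
  assumes E: "finite E" "E \<noteq> {}" and gcd: "Gcd E = 1" and d: "d > 0"
    and step: "\<And>x. x \<in> E \<Longrightarrow> x \<noteq> 0 \<Longrightarrow> x + d \<in> E"
  shows "d = 1 \<and> E = {1 - int (card E)..0}"
proof -
  have "Max E = 0"
  proof (rule ccontr)
    assume "Max E \<noteq> 0"
    then have "Max E + d \<in> E" using step Max_in[OF E] by blast
    then show False using Max_ge[OF E(1)] d by fastforce
  qed
  then have nonpos: "x \<le> 0" if "x \<in> E" for x using Max_ge[OF E(1) that] by simp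
  have dvd: "x \<in> E \<Longrightarrow> d dvd x" for x
  proof (induction "nat (- x)" arbitrary: x rule: less_induct)
    case less
    show ?case
    proof (cases "x = 0")
      case False
      have xd: "x + d \<in> E" using step[OF less.prems False] .
      have "nat (- (x + d)) < nat (- x)" using nonpos[OF xd] d by simp
      then have "d dvd x + d" using less.hyps xd by blast
      then show ?thesis by simp
    qed simp
  qed
  have "d dvd Gcd E" using dvd by (rule Gcd_greatest)
  then have d1: "d = 1" using gcd d by simp
  define a where "a = Min E"
  have aE: "a \<in> E" unfolding a_def using Min_in[OF E] .
  have up: "a + int k \<in> E" if "a + int k \<le> 0" for k
    using that
  proof (induction k)
    case (Suc k)
    then have "a + int k \<in> E" "a + int k \<noteq> 0" by auto
    then have "a + int k + 1 \<in> E" using step d1 by blast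
    then show ?case by (simp add: algebra_simps)
  qed (simp add: aE)
  have "E = {a..0}"
  proof
    show "E \<subseteq> {a..0}" using nonpos Min_le[OF E(1)] by (auto simp: a_def)
    show "{a..0} \<subseteq> E"
    proof
      fix x assume "x \<in> {a..0}"
      then show "x \<in> E" using up[of "nat (x - a)"] by simp
    qed
  qed
  moreover have "1 - int (card {a..0}) = a" using nonpos[OF aE] by simp
  ultimately show ?thesis using d1 by metis
qed

lemma strict_mono_onto_interval:
  fixes e :: "'n::{finite,linorder} \<Rightarrow> int"
  assumes e: "strict_mono e" and "range e = {a..b}"
  shows "e i = a + int (index i)"
proof -
  have "e ` {..<i} = {a..<e i}"
  proof
    have "a \<le> e j" for j using assms(2) by (metis atLeastAtMost_iff rangeI)
    then show "e ` {..<i} \<subseteq> {a..<e i}" using e by (auto simp: strict_mono_less)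
    show "{a..<e i} \<subseteq> e ` {..<i}"
    proof
      fix x assume x: "x \<in> {a..<e i}"
      have "e i \<le> b" using assms(2) by (metis atLeastAtMost_iff rangeI)
      then have "x \<in> range e" using x assms(2) by simp
      then obtain j where "x = e j" by blast
      then show "x \<in> e ` {..<i}" using x e by (auto simp: strict_mono_less)
    qed
  qed
  then have "card {a..<e i} = index i"
    using card_image[OF strict_mono_imp_inj_on[OF e, THEN inj_on_subset[OF _ subset_UNIV]], of "{..<i}"]
    by (simp add: index_def)
  moreover have "a \<le> e i" using assms(2) by (metis atLeastAtMost_iff rangeI)
  ultimately show ?thesis by simp
qed

text \<open>For \<open>d < 0\<close> the set of exponents is reflected at \<open>0\<close>.\<close>

lemma shifted_exponents:
  fixes e :: "'n::{finite,linorder} \<Rightarrow> int"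
  assumes e: "strict_mono e" and gcd: "Gcd (range e) = 1" and d: "d \<noteq> 0"
    and step: "\<And>i. e i \<noteq> 0 \<Longrightarrow> e i + d \<in> range e"
  shows "d = -1 \<and> e = (\<lambda>i. int (index i)) \<or>
    d = 1 \<and> e = (\<lambda>i. int (index i) - int CARD('n) + 1)"
proof -
  have card: "card (range e) = CARD('n)" using card_image[OF strict_mono_imp_inj_on[OF e]] .
  show ?thesis
  proof (cases "d > 0")
    case True
    have "d = 1 \<and> range e = {1 - int (card (range e))..0}"
      by (rule shift_invariant_exponents[OF _ _ gcd True]) (use step in auto)
    then show ?thesis using strict_mono_onto_interval[OF e, of "1 - int CARD('n)" 0] card
      by (auto simp: fun_eq_iff)
  next
    case False
    have "Gcd (range (\<lambda>i. - e i)) dvd e i" for i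
      using Gcd_dvd[of "- e i" "range (\<lambda>i. - e i)"] by auto
    then have "Gcd (range (\<lambda>i. - e i)) dvd Gcd (range e)" by (intro Gcd_greatest) auto
    then have gcd': "Gcd (range (\<lambda>i. - e i)) = 1"
      using gcd Gcd_int_greater_eq_0[of "range (\<lambda>i. - e i)"] by simp
    have "- d = 1 \<and> range (\<lambda>i. - e i) = {1 - int (card (range (\<lambda>i. - e i)))..0}"
    proof (rule shift_invariant_exponents[OF _ _ gcd'])
      show "- d > 0" using False d by simp
      fix x assume "x \<in> range (\<lambda>i. - e i)" "x \<noteq> 0"
      then obtain i where i: "x = - e i" "e i \<noteq> 0" by auto
      then obtain k where "e i + d = e k" using step by blast
      then have "x + - d = - e k" using i by simp
      then show "x + - d \<in> range (\<lambda>i. - e i)" by blast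
    qed auto
    moreover have "inj e" by (rule strict_mono_imp_inj_on[OF e])
    then have "inj (\<lambda>i. - e i)" by (simp add: inj_on_def)
    then have "card (range (\<lambda>i. - e i)) = CARD('n)" by (rule card_image)
    ultimately have d1: "d = -1" and "range (\<lambda>i. - e i) = {1 - int CARD('n)..0}" by auto
    then have "uminus ` range (\<lambda>i. - e i) = uminus ` {1 - int CARD('n)..0}" by simp
    then have "range e = {0..int CARD('n) - 1}" by (simp add: image_image)
    then show ?thesis using strict_mono_onto_interval[OF e] d1 by (auto simp: fun_eq_iff)
  qed
qed

section \<open>The dimension of the Lie algebra\<close>

lemma index_surj:
  assumes "m < CARD('n)" shows "\<exists>i :: 'n::{finite,linorder}. index i = m"
proof -
  have "card (range (index :: 'n \<Rightarrow> nat)) = CARD('n)"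
    by (rule card_image[OF strict_mono_imp_inj_on[OF strict_mono_index]])
  then have "range (index :: 'n \<Rightarrow> nat) = {..<CARD('n)}"
    using index_less by (intro card_subset_eq) auto
  then show ?thesis using assms by (metis imageE lessThan_iff)
qed

lemma conjugation_scale: "G ** mat_scale c N ** g = mat_scale c (G ** N ** g)"
  by (simp add: vec_eq_iff matrix_matrix_mult_def mat_scale_def sum_distrib_left sum_distrib_right mult_ac)

lemma conjugation_add: "G ** (M + N) ** g = G ** M ** g + G ** N ** g"
  for G M N g :: "complex ^ 'n::finite ^ 'n"
  by (simp add: vec_eq_iff matrix_matrix_mult_def distrib_left distrib_right sum.distrib)

lemma conjugation_inverse:
  fixes g G B :: "complex ^ 'n::finite ^ 'n"
  assumes "g ** G = mat 1" "G ** g = mat 1"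
  shows "G ** (g ** B ** G) ** g = B" "g ** (G ** B ** g) ** G = B"
  by (metis assms matrix_mul_assoc matrix_mul_lid matrix_mul_rid)+

lemma power_form_inverse:
  fixes \<phi> :: "ratfun ^ 'n::{finite,linorder}"
  assumes "power_form \<phi> g r e"
  obtains G where "g ** G = mat 1" "G ** g = mat 1"
  using assms by (auto simp: power_form_def invertible_def)

lemma power_form_exponent_nonzero:
  fixes \<phi> :: "ratfun ^ 'n::{finite,linorder}"
  assumes "power_form \<phi> g r e"
  obtains i where "e i \<noteq> 0"
proof -
  have "\<exists>i. e i \<noteq> 0"
  proof (rule ccontr)
    assume "\<not> ?thesis"
    then have "range e = {0}" by auto
    then show False using assms by (simp add: power_form_def)
  qed
  then show thesis using that by blast
qed

lemma power_form_torus: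
  fixes \<phi> :: "ratfun ^ 'n::{finite,linorder}"
  assumes pf: "power_form \<phi> g r e" and gG: "g ** G = mat 1" "G ** g = mat 1"
  defines "T \<equiv> G ** diag_mat (\<lambda>i. of_int (e i)) ** g"
  shows "T \<in> lie_algebra (linear_symmetries (zariski_closure (ratmap_image \<phi>)))" and "T \<noteq> 0"
proof -
  have "inj e" using pf by (auto simp: power_form_def intro: strict_mono_imp_inj_on)
  then show "T \<in> lie_algebra (linear_symmetries (zariski_closure (ratmap_image \<phi>)))"
    unfolding T_def zariski_closure_power_form[OF pf gG(2)] by (rule torus_in_lie_algebra[OF gG])
  show "T \<noteq> 0"
  proof
    assume "T = 0"
    then have D0: "diag_mat (\<lambda>i. of_int (e i)) = (0 :: complex ^ ('n::{finite,linorder}) ^ ('n::{finite,linorder}))"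
      using conjugation_inverse(2)[OF gG, of "diag_mat (\<lambda>i. of_int (e i))"] by (simp add: T_def)
    obtain i where "e i \<noteq> 0" using power_form_exponent_nonzero[OF pf] .
    then show False using arg_cong[OF D0, of "\<lambda>M. M $ i $ i"] by (simp add: diag_mat_def)
  qed
qed

text \<open>In the two exceptional cases \<open>- d e\<^sub>i\<close> runs through \<open>0, \<dots>, n - 1\<close>, and \<open>y\<^bsup>e\<^sub>i\<^esup>\<close> is the power
  with this exponent of \<open>y\<^bsup>-d\<^esup>\<close>.\<close>

lemma power_form_unipotent:
  fixes \<phi> :: "ratfun ^ 'n::{finite,linorder}"
  assumes pf: "power_form \<phi> g r e" and gG: "g ** G = mat 1" "G ** g = mat 1"
    and d: "d = -1 \<and> e = (\<lambda>i. int (index i)) \<or> d = 1 \<and> e = (\<lambda>i. int (index i) - int CARD('n) + 1)"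
  shows "G ** (\<chi> i k. if e k = e i + d then of_int (- d * e i) else 0) ** g
    \<in> lie_algebra (linear_symmetries (zariski_closure (ratmap_image \<phi>)))"
proof -
  \<comment> \<open>Equal to \<open>index i\<close> for \<open>d = -1\<close> and to \<open>n - 1 - index i\<close> for \<open>d = 1\<close>.\<close>
  define \<sigma> where "\<sigma> i = nat (- d * e i)" for i
  have lt: "index i < CARD('n)" for i :: 'n by (rule index_less)
  have \<sigma>: "int (\<sigma> i) = - d * e i" and \<sigma>_less: "\<sigma> i < CARD('n)" for i
    using d lt[of i] by (auto simp: \<sigma>_def)
  have "inj e" using pf by (auto simp: power_form_def intro: strict_mono_imp_inj_on)
  have e_\<sigma>: "e i = - d * int (\<sigma> i)" for i using \<sigma>[of i] d by auto
  have "inj \<sigma>"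
  proof (rule injI)
    fix i j assume "\<sigma> i = \<sigma> j"
    then have "e i = e j" by (simp only: e_\<sigma>)
    then show "i = j" using \<open>inj e\<close> by (simp add: inj_eq)
  qed
  then have "card (range \<sigma>) = card {..<CARD('n)}" by (simp add: card_image)
  moreover have "range \<sigma> \<subseteq> {..<CARD('n)}" using \<sigma>_less by auto
  ultimately have "range \<sigma> = {..<CARD('n)}" by (intro card_subset_eq) auto
  then have bij: "bij_betw \<sigma> UNIV {..<CARD('n)}" using \<open>inj \<sigma>\<close> by (simp add: bij_betw_def)
  have N: "(\<chi> i k. if e k = e i + d then of_int (- d * e i) else 0) =
      ((\<chi> i k. if Suc (\<sigma> k) = \<sigma> i then of_nat (\<sigma> i) else 0) :: complex ^ ('n::{finite,linorder}) ^ ('n::{finite,linorder}))"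
  proof -
    have "e k = e i + d \<longleftrightarrow> Suc (\<sigma> k) = \<sigma> i" for i k
      using \<sigma>[of i] \<sigma>[of k] d by auto
    moreover have "(of_int (- d * e i) :: complex) = of_nat (\<sigma> i)" for i
      by (metis \<sigma> of_int_of_nat_eq)
    ultimately show ?thesis by (simp add: vec_eq_iff)
  qed
  have "(\<lambda>y. G *v power_vec e y) ` (- {0}) = (\<lambda>y. G *v power_vec (\<lambda>i. int (\<sigma> i)) y) ` (- {0})"
  proof -
    have pv: "power_vec e y = power_vec (\<lambda>i. int (\<sigma> i)) (y powi (- d))" for y
      using d by (auto simp: power_vec_def \<sigma> vec_eq_iff simp flip: power_int_mult)
    have im: "(\<lambda>y. y powi (- d)) ` (- {0}) = - {0 :: complex}"
    proof
      show "- {0 :: complex} \<subseteq> (\<lambda>y. y powi (- d)) ` (- {0})"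
      proof
        fix y :: complex assume "y \<in> - {0}"
        then show "y \<in> (\<lambda>y. y powi (- d)) ` (- {0})"
          using d by (intro image_eqI[of _ _ "y powi (- d)"]) (auto simp flip: power_int_mult)
      qed
    qed auto
    have "(\<lambda>y. G *v power_vec e y) ` (- {0}) =
        (\<lambda>y. G *v power_vec (\<lambda>i. int (\<sigma> i)) y) ` ((\<lambda>y. y powi (- d)) ` (- {0}))"
      unfolding pv by (simp only: image_image)
    then show ?thesis by (simp only: im)
  qed
  then show ?thesis
    unfolding N zariski_closure_power_form[OF pf gG(2)]
    using unipotent_in_lie_algebra[OF gG bij] by (simp add: zariski_closure_add_zero)
qed

text \<open>Conjugated to power coordinates, every element of the Lie algebra has entries
  \<open>e\<^sub>i h(e\<^sub>k - e\<^sub>i)\<close>. The value \<open>h(0)\<close> belongs to the torus, and the only other value that can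
  be nonzero, at \<open>d = \<plusminus>1\<close> in the exceptional cases, belongs to the translations.\<close>

lemma power_form_dim:
  fixes \<phi> :: "ratfun ^ 'n::{finite,linorder}"
  assumes card: "CARD('n) \<ge> 2"
    and span: "vec.span (zariski_closure (ratmap_image \<phi>)) = UNIV"
    and pf: "power_form \<phi> g r e"
  shows "cmat.dim (lie_algebra (linear_symmetries (zariski_closure (ratmap_image \<phi>)))) =
    (if e = (\<lambda>i. int (index i)) \<or> e = (\<lambda>i. int (index i) - int CARD('n) + 1) then 2 else 1)"
proof -
  define L where "L = lie_algebra (linear_symmetries (zariski_closure (ratmap_image \<phi>)))"
  obtain G where gG: "g ** G = mat 1" "G ** g = mat 1" using power_form_inverse[OF pf] .
  have mono: "strict_mono e" and gcd: "Gcd (range e) = 1" using pf by (auto simp: power_form_def)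
  have inj: "inj e" using mono by (rule strict_mono_imp_inj_on)
  obtain j0 where j0: "\<phi> $ j0 \<notin> range rf_const"
    using rf_independent_nonconst[of \<phi>, OF card] rf_independent_of_spanning[OF span] by metis
  define D where "D = diag_mat (\<lambda>i. of_int (e i))"
  define T where "T = G ** D ** g"
  have T: "T \<in> L" "T \<noteq> 0"
    using power_form_torus[OF pf gG] by (auto simp: T_def D_def L_def)
  have weights: "\<exists>h. (\<forall>i k. (g ** A ** G) $ i $ k = of_int (e i) * h (e k - e i)) \<and>
      (\<forall>d. h d \<noteq> 0 \<longrightarrow> d \<noteq> 0 \<longrightarrow> d = -1 \<and> e = (\<lambda>i. int (index i)) \<or>
        d = 1 \<and> e = (\<lambda>i. int (index i) - int CARD('n) + 1))" if A: "A \<in> L" for A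
  proof -
    obtain h where h: "\<And>i k. (g ** A ** G) $ i $ k = of_int (e i) * h (e k - e i)"
      "\<And>d i. h d \<noteq> 0 \<Longrightarrow> e i \<noteq> 0 \<Longrightarrow> e i + d \<in> range e"
      by (rule power_form_symmetry_weights[OF pf gG A[unfolded L_def] j0]) (rule that)
    then show ?thesis using shifted_exponents[OF mono gcd] by blast
  qed
  show ?thesis
  proof (cases "e = (\<lambda>i. int (index i)) \<or> e = (\<lambda>i. int (index i) - int CARD('n) + 1)")
    case False
    have "L \<subseteq> cmat.span {T}"
    proof
      fix A assume "A \<in> L"
      then obtain h where h: "\<And>i k. (g ** A ** G) $ i $ k = of_int (e i) * h (e k - e i)"
        "\<And>d. d \<noteq> 0 \<Longrightarrow> h d = 0" using weights False by metis
      have "g ** A ** G = mat_scale (h 0) D"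
        using h by (auto simp: vec_eq_iff D_def diag_mat_def mat_scale_def inj_eq[OF inj])
      then have "A = mat_scale (h 0) T"
        using conjugation_inverse(1)[OF gG, of A] by (simp add: T_def conjugation_scale)
      then show "A \<in> cmat.span {T}" by (auto simp: cmat.span_singleton)
    qed
    then have "cmat.dim L = 1"
      using T by (intro cmat.dim_unique[of "{T}"]) auto
    then show ?thesis using False by (simp add: L_def)
  next
    case True
    then obtain d :: int where d: "d = -1 \<and> e = (\<lambda>i. int (index i)) \<or>
        d = 1 \<and> e = (\<lambda>i. int (index i) - int CARD('n) + 1)" by blast
    have unique: "d' = d" if "d' = -1 \<and> e = (\<lambda>i. int (index i)) \<or>
        d' = 1 \<and> e = (\<lambda>i. int (index i) - int CARD('n) + 1)" for d' :: int
    proof (rule ccontr)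
      assume "d' \<noteq> d"
      then have "(\<lambda>i::'n. int (index i)) = (\<lambda>i. int (index i) - int CARD('n) + 1)"
        using that d by auto
      from fun_cong[OF this, of undefined] show False using card by simp
    qed
    define N where "N = ((\<chi> i k. if e k = e i + d then of_int (- d * e i) else 0)
      :: complex ^ ('n::{finite,linorder}) ^ ('n::{finite,linorder}))"
    define U where "U = G ** N ** g"
    have U: "U \<in> L" using power_form_unipotent[OF pf gG d] by (simp add: U_def N_def L_def)
    have d0: "d \<noteq> 0" "(of_int d :: complex) * of_int d = 1" using d by auto
    obtain i where i: "e i \<noteq> 0" using power_form_exponent_nonzero[OF pf] .
    have "U \<noteq> 0"
    proof
      assume "U = 0"
      then have N0: "N = 0" using conjugation_inverse(2)[OF gG, of N] by (simp add: U_def)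
      have "\<exists>a b. e a = - d \<and> e b = 0"
      proof (cases "d = 1")
        case True
        then have e: "e = (\<lambda>i. int (index i) - int CARD('n) + 1)" using d by auto
        \<comment> \<open>The last two exponents are \<open>-1\<close> and \<open>0\<close>.\<close>
        obtain a b :: 'n where "index a = CARD('n) - 2" "index b = CARD('n) - 1"
          using index_surj[where 'n = 'n] card by (metis diff_less less_le_trans pos2 zero_less_one)
        then show ?thesis using card True by (intro exI[of _ a] exI[of _ b]) (simp add: e of_nat_diff)
      next
        case False
        then have e: "d = -1" "e = (\<lambda>i. int (index i))" using d by auto
        obtain a b :: 'n where "index a = 1" "index b = 0"
          using index_surj[of 1, where 'n = 'n] index_surj[of 0, where 'n = 'n] card by auto
        then show ?thesis by (intro exI[of _ a] exI[of _ b]) (simp add: e)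
      qed
      then obtain a b where ab: "e a = - d" "e b = 0" by blast
      have "N $ a $ b = of_int (d * d)" using ab by (simp add: N_def)
      then show False using N0 d0 by simp
    qed
    moreover have "T \<notin> cmat.span {U}"
    proof
      assume "T \<in> cmat.span {U}"
      then obtain c where "T = mat_scale c U" by (auto simp: cmat.span_singleton)
      then have "D = mat_scale c N"
        using conjugation_inverse(2)[OF gG, of D] conjugation_inverse(2)[OF gG, of "mat_scale c N"]
        by (simp add: T_def U_def conjugation_scale)
      then have "D $ i $ i = c * N $ i $ i" by (simp add: mat_scale_def)
      then show False using i d0 by (simp add: D_def N_def diag_mat_def)
    qed
    ultimately have ind: "cmat.independent {T, U}" and "T \<noteq> U"
      using cmat.independent_insert[of T "{U}"] cmat.span_base[of U "{U}"] by auto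
    have "L \<subseteq> cmat.span {T, U}"
    proof
      fix A assume "A \<in> L"
      then obtain h where h: "\<And>i k. (g ** A ** G) $ i $ k = of_int (e i) * h (e k - e i)"
        "\<And>m. m \<noteq> 0 \<Longrightarrow> m \<noteq> d \<Longrightarrow> h m = 0" using weights unique by metis
      have "(g ** A ** G) $ i $ k = (mat_scale (h 0) D + mat_scale (- of_int d * h d) N) $ i $ k" for i k
      proof -
        consider "i = k" | "e k = e i + d" "i \<noteq> k" | "e k - e i \<noteq> 0" "e k - e i \<noteq> d" "i \<noteq> k" 
          using inj_eq[OF inj, of i k] by force
        then show ?thesis
        proof cases
          case 2
          have "of_int (e i) * h d = (of_int d * of_int d) * (of_int (e i) * h d)" by (simp add: d0)
          then show ?thesis using 2 by (simp add: h D_def N_def diag_mat_def mat_scale_def mult_ac)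
        qed (use d0 in \<open>auto simp: h D_def N_def diag_mat_def mat_scale_def\<close>)
      qed
      then have "g ** A ** G = mat_scale (h 0) D + mat_scale (- of_int d * h d) N"
        by (simp add: vec_eq_iff)
      then have "A = G ** (mat_scale (h 0) D + mat_scale (- of_int d * h d) N) ** g"
        using conjugation_inverse(1)[OF gG, of A] by (simp only:)
      also have "\<dots> = mat_scale (h 0) T + mat_scale (- of_int d * h d) U"
        by (simp only: T_def U_def conjugation_scale conjugation_add)
      also have "\<dots> \<in> cmat.span {T, U}"
        by (intro cmat.span_add cmat.span_scale cmat.span_base insertI1 insertI2)
      finally show "A \<in> cmat.span {T, U}" .
    qed
    then have "cmat.dim L = 2"
      using T U ind \<open>T \<noteq> U\<close> by (intro cmat.dim_unique[of "{T, U}"]) auto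
    then show ?thesis using True by (simp add: L_def)
  qed
qed

theorem theorem7p2:
  fixes \<phi> :: "ratfun ^ ('n::{finite,linorder})"
    and X :: "(complex ^ ('n::{finite,linorder})) set"
  assumes "CARD('n) \<ge> 2"
    and "X = zariski_closure (ratmap_image \<phi>)"
    and "vec.span X = UNIV"
  shows "(lie_algebra (linear_symmetries X) \<noteq> {0} \<longleftrightarrow> (\<exists>g r e. power_form \<phi> g r e)) \<and>
    (\<forall>g r e. power_form \<phi> g r e \<longrightarrow>
       cmat.dim (lie_algebra (linear_symmetries X)) =
         (if e = (\<lambda>i. int (index i)) \<or> e = (\<lambda>i. int (index i) - int CARD('n) + 1)
          then 2 else 1))"
proof (intro conjI iffI allI impI)
  have span: "vec.span (zariski_closure (ratmap_image \<phi>)) = UNIV" using assms by simp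
  show "\<exists>g r e. power_form \<phi> g r e" if ne: "lie_algebra (linear_symmetries X) \<noteq> {0}"
  proof -
    have "mat_scale s 0 = 0" for s by (simp add: mat_scale_def vec_eq_iff)
    then have "0 \<in> lie_algebra (linear_symmetries X)" by (simp add: lie_algebra_def)
    then obtain A where "A \<in> lie_algebra (linear_symmetries X)" "A \<noteq> 0" using ne by blast
    then show ?thesis using power_form_of_nonzero_symmetry[OF assms(1) span] assms(2) by blast
  qed
  show "lie_algebra (linear_symmetries X) \<noteq> {0}" if pow: "\<exists>g r e. power_form \<phi> g r e"
  proof -
    obtain g r e where pf: "power_form \<phi> g r e" using pow by blast
    obtain G where "g ** G = mat 1" "G ** g = mat 1" using power_form_inverse[OF pf] .
    from power_form_torus[OF pf this] show ?thesis using assms(2) by blast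
  qed
  show "cmat.dim (lie_algebra (linear_symmetries X)) =
      (if e = (\<lambda>i. int (index i)) \<or> e = (\<lambda>i. int (index i) - int CARD('n) + 1) then 2 else 1)"
    if "power_form \<phi> g r e" for g r e
    using power_form_dim[OF assms(1) span that] assms(2) by simp
qed

end
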